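(* Let $S=\langle n_1,n_2,n_3,n_4\rangle$ be a $4$-generated pseudo symmetric numerical semigroup with defining integers $\alpha_1,\alpha_2,\alpha_3,\alpha_4,\alpha_{21}$. Suppose $n_2$ is the smallest number in $\{n_1,n_2,n_3,n_4\}$. The tangent cone of the monomial curve $C_S$ at the origin is Cohen-Macaulay if and only if all of the following hold: (1) $\alpha_{21}+\alpha_3\le \alpha_1$, (2) $\alpha_{21}+\alpha_3\le \alpha_4$, (3) $\alpha_4\le \alpha_2+\alpha_3-1$, (4) $\alpha_{21}+\alpha_1\le \alpha_4+\alpha_2-1$.
   Context: Setting. $n_1,\dots,n_4$ are positive integers with $\gcd(n_1,\dots,n_4)=1$, and $S=\langle n_1,\dots,n_4\rangle=\{u_1n_1+\cdots+u_4n_4 \mid u_i\in\mathbb N\}$ ($0\in\mathbb N$) is the numerical semigroup they generate; $S$ is $4$-generated, i.e. $n_1,\dots,n_4$ is its minimal generating set. The set of pseudo Frobenius numbers is $PF(S)=\{n\in\mathbb Z\setminus S \mid n+s\in S \text{ for all } s\in S\setminus\{0\}\}$, and $g(S)=\max PF(S)$ is the Frobenius number. $S$ is pseudo symmetric if $PF(S)=\{g(S)/2,g(S)\}$. By a theorem of Komeda, for $S$ pseudo symmetric the generators can be labelled so that there are integers $\alpha_i>1$ ($1\le i\le 4$) and $\alpha_{21}$ with $0<\alpha_{21}<\alpha_1$ such that $n_1=\alpha_2\alpha_3(\alpha_4-1)+1$, $n_2=\alpha_{21}\alpha_3\alpha_4+(\alpha_1-\alpha_{21}-1)(\alpha_3-1)+\alpha_3$,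 $n_3=\alpha_1\alpha_4+(\alpha_1-\alpha_{21}-1)(\alpha_2-1)(\alpha_4-1)-\alpha_4+1$, $n_4=\alpha_1\alpha_2(\alpha_3-1)+\alpha_{21}(\alpha_2-1)+\alpha_2$. Such a labelling and such integers (the defining integers of $S$) are fixed. Minimality of the generating set forces $\alpha_1-\alpha_{21}\ge 2$. Let $K$ be a field, $A=K[X_1,\dots,X_4]$, and let $I_S$ be the kernel of $A\to K[t^{n_1},\dots,t^{n_4}]$, $X_i\mapsto t^{n_i}$. $C_S$ is the affine monomial curve parametrized by $X_i=t^{n_i}$, with local ring $R_S=K[[t^{n_1},\dots,t^{n_4}]]$ at the origin and maximal ideal $m$. For nonzero $f\in A$, $f_*$ denotes its homogeneous summand of least total degree (standard grading), and ${I_S}_*$ is the ideal generated by all $f_*$ with $0\neq f\in I_S$. The associated graded ring $gr_m(R_S)$ is isomorphic to $A/{I_S}_*$; the tangent cone of $C_S$ at the origin is Cohen-Macaulay if this ring is Cohen-Macaulay. *)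

theory Defs
  imports
    "HOL-Analysis.Finite_Cartesian_Product"
    "HOL-Library.Poly_Mapping"
    "HOL-Library.Extended_Nat"
    "HOL-Computational_Algebra.Polynomial"
    "HOL-Algebra.QuotRing"
    "HOL-Algebra.Ring_Divisibility"
    "HOL-Algebra.Algebraic_Closure_Type"
begin

section \<open>Cohen-Macaulay rings\<close>

text \<open>
  The general definition for a Noetherian commutative ring, in the form that needs no localization
  (Kaplansky; Eisenbud, Section 18.2): every maximal ideal has depth equal to its height.
\<close>

definition regular_sequence :: "('a, 'b) ring_scheme \<Rightarrow> 'a list \<Rightarrow> bool" where
  "regular_sequence R xs \<longleftrightarrow>
     set xs \<subseteq> carrier R \<and>
     Idl\<^bsub>R\<^esub> (set xs) \<noteq> carrier R \<and>
     (\<forall>i<length xs. \<forall>y\<in>carrier R.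
        xs ! i \<otimes>\<^bsub>R\<^esub> y \<in> Idl\<^bsub>R\<^esub> (set (take i xs)) \<longrightarrow> y \<in> Idl\<^bsub>R\<^esub> (set (take i xs)))"

definition ideal_depth :: "('a, 'b) ring_scheme \<Rightarrow> 'a set \<Rightarrow> enat" where
  "ideal_depth R I = (SUP xs\<in>{xs. set xs \<subseteq> I \<and> regular_sequence R xs}. enat (length xs))"

definition prime_height :: "('a, 'b) ring_scheme \<Rightarrow> 'a set \<Rightarrow> enat" where
  "prime_height R P =
     (SUP k\<in>{k. \<exists>c. (\<forall>i\<le>k. primeideal (c i) R) \<and> (\<forall>i<k. c i \<subset> c (Suc i)) \<and> c k = P}. enat k)"

definition cohen_macaulay :: "('a, 'b) ring_scheme \<Rightarrow> bool" where
  "cohen_macaulay R \<longleftrightarrow>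
     cring R \<and> noetherian_ring R \<and>
     (\<forall>M. maximalideal M R \<longrightarrow> ideal_depth R M = prime_height R M)"


section \<open>Monomial curves and their tangent cones\<close>

text \<open>
  The polynomial ring in four variables over \<^typ>\<open>'k\<close>: a polynomial is a finitely supported
  map from exponent vectors to coefficients, with the convolution product.  The index type
  \<^typ>\<open>4\<close> has the elements 1, 2, 3 and 4 (where 4 = 0).
\<close>

type_synonym 'k poly4 = "(nat ^ 4) \<Rightarrow>\<^sub>0 'k"

abbreviation poly4_ring :: "'k :: field poly4 ring" where
  "poly4_ring \<equiv> ring_of_type_algebra"

definition monomial_map :: "nat ^ 4 \<Rightarrow> 'k :: field poly4 \<Rightarrow> 'k poly" where
  "monomial_map n f =
     (\<Sum>e\<in>Poly_Mapping.keys f.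
        Polynomial.monom (Poly_Mapping.lookup f e) (\<Sum>i\<in>UNIV. e $ i * n $ i))"

definition curve_ideal :: "nat ^ 4 \<Rightarrow> 'k :: field poly4 set" where
  "curve_ideal n = {f. monomial_map n f = 0}"

definition total_degree :: "nat ^ 4 \<Rightarrow> nat" where
  "total_degree e = (\<Sum>i\<in>UNIV. e $ i)"

text \<open>The homogeneous summand of least total degree (only meaningful for nonzero \<open>f\<close>).\<close>

definition initial_form :: "'k :: field poly4 \<Rightarrow> 'k poly4" where
  "initial_form f =
     (\<Sum>e\<in>{e \<in> Poly_Mapping.keys f. total_degree e = Min (total_degree ` Poly_Mapping.keys f)}.
        Poly_Mapping.single e (Poly_Mapping.lookup f e))"

definition tangent_cone_ideal :: "nat ^ 4 \<Rightarrow> 'k :: field poly4 set" where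
  "tangent_cone_ideal n = Idl\<^bsub>poly4_ring\<^esub> {initial_form f | f. f \<in> curve_ideal n \<and> f \<noteq> 0}"

definition tangent_cone_ring :: "nat ^ 4 \<Rightarrow> 'k :: field poly4 set ring" where
  "tangent_cone_ring n = poly4_ring Quot (tangent_cone_ideal n)"


section \<open>Pseudo symmetric numerical semigroups\<close>

text \<open>
  Semigroups are taken as sets of integers, since pseudo Frobenius numbers range over the integers.
\<close>

definition semigroup_gen :: "4 set \<Rightarrow> nat ^ 4 \<Rightarrow> int set" where
  "semigroup_gen J n = {(\<Sum>i\<in>J. int (u i * n $ i)) | u :: 4 \<Rightarrow> nat. True}"

definition minimal_generators :: "nat ^ 4 \<Rightarrow> bool" where
  "minimal_generators n \<longleftrightarrow> (\<forall>J. J \<noteq> UNIV \<longrightarrow> semigroup_gen J n \<noteq> semigroup_gen UNIV n)"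

definition pseudo_frobenius :: "int set \<Rightarrow> int set" where
  "pseudo_frobenius S = {x. x \<notin> S \<and> (\<forall>s\<in>S - {0}. x + s \<in> S)}"

definition frobenius_number :: "int set \<Rightarrow> int" where
  "frobenius_number S = Max (pseudo_frobenius S)"

text \<open>
  Evenness of the Frobenius number is part of the condition, because its half has to be an integer;
  without it \<open>div\<close> would round, and the semigroup of all naturals would qualify.
\<close>

definition pseudo_symmetric :: "int set \<Rightarrow> bool" where
  "pseudo_symmetric S \<longleftrightarrow>
     even (frobenius_number S) \<and>
     pseudo_frobenius S = {frobenius_number S div 2, frobenius_number S}"

definition defining_integers ::
    "nat ^ 4 \<Rightarrow> int \<Rightarrow> int \<Rightarrow> int \<Rightarrow> int \<Rightarrow> int \<Rightarrow> bool" where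
  "defining_integers n \<alpha>1 \<alpha>2 \<alpha>3 \<alpha>4 \<alpha>21 \<longleftrightarrow>
     \<alpha>1 > 1 \<and> \<alpha>2 > 1 \<and> \<alpha>3 > 1 \<and> \<alpha>4 > 1 \<and> 0 < \<alpha>21 \<and> \<alpha>21 < \<alpha>1 \<and>
     int (n $ 1) = \<alpha>2 * \<alpha>3 * (\<alpha>4 - 1) + 1 \<and>
     int (n $ 2) = \<alpha>21 * \<alpha>3 * \<alpha>4 + (\<alpha>1 - \<alpha>21 - 1) * (\<alpha>3 - 1) + \<alpha>3 \<and>
     int (n $ 3) = \<alpha>1 * \<alpha>4 + (\<alpha>1 - \<alpha>21 - 1) * (\<alpha>2 - 1) * (\<alpha>4 - 1) - \<alpha>4 + 1 \<and>
     int (n $ 4) = \<alpha>1 * \<alpha>2 * (\<alpha>3 - 1) + \<alpha>21 * (\<alpha>2 - 1) + \<alpha>2"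

end

theory Submission
  imports Defs "HOL-Analysis.Cartesian_Space" "HOL-Number_Theory.Cong"
begin

text \<open>
For an exponent vector \<open>e\<close> put \<open>weight n e = \<Sum>i. e i * n i\<close>, the element of the semigroup that \<open>e\<close>
factors, and call \<open>e\<close> longest if no other factorization of the same element has larger total
degree.  The tangent cone ring has a \<open>K\<close>-basis indexed by the semigroup: a monomial \<open>X^e\<close> vanishes
in it unless \<open>e\<close> is longest, and two longest monomials agree in it exactly when their weights do
(\<open>tangent_cone_ideal_eq\<close>).

Because \<open>n 2\<close> is strictly smaller than the other generators, \<open>X i ^ n 2\<close> for \<open>i \<noteq> 2\<close> has the same
weight as the longer monomial \<open>X 2 ^ n i\<close>, so it vanishes.  The tangent cone ring is therefore finite
over \<open>K[X 2]\<close> and becomes \<open>K[X 2]\<close> when its nilpotents are divided out.  A ring of this kind has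
dimension one at every maximal ideal, and what remains is whether every maximal ideal contains a
regular element.  If it does at the origin, then \<open>X 2\<close> is regular
(\<open>cohen_macaulay_imp_regular\<close>); conversely, if \<open>X 2\<close> is regular, then the basis description embeds
the ring, as a \<open>K[X 2]\<close>-module, into \<open>K[t]\<close> with \<open>X 2\<close> acting as \<open>t ^ n 2\<close>, and every nonzero
polynomial in \<open>X 2\<close> is regular (\<open>cohen_macaulayI\<close>).  So the ring is Cohen-Macaulay if and only if a
longest factorization stays longest when one copy of \<open>n 2\<close> is added
(\<open>cohen_macaulay_iff_longest_stable\<close>).

That property is decided by five relations between the generators, the weights of the two sides of
the binomials (with \<open>b = \<alpha>21\<close>)
  \<open>X1^a1 - X3 X4^(a4-1)\<close>, \<open>X1^b X4 - X2^a2\<close>, \<open>X3^a3 - X1^(a1-b-1) X2\<close>,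
  \<open>X4^a4 - X1 X2^(a2-1) X3^(a3-1)\<close>, \<open>X1^(b+1) X3^(a3-1) - X2 X4^(a4-1)\<close>.
Rewriting from left to right ends in a power of \<open>X2\<close> times a normal monomial in \<open>X1, X3, X4\<close>.  Since
the generators have no common divisor, the normal monomials meet every residue class modulo \<open>n 2\<close>;
the formula for \<open>n 2\<close> counts them, so each class is met once and the normal form of a factorization
depends on its weight only.  This gives control over all factorizations without generators of the
curve ideal.  The four inequalities say that
neither the last three steps nor the step \<open>X1^(a1+b) \<rightarrow> X2^a2 X3 X4^(a4-2)\<close>, combined from the first
two, shortens a factorization; then the second step does not shorten it either.  So if they hold, any
factorization of an element that has some factorization with \<open>X2\<close> can be replaced by one that contains
\<open>X2\<close> and is at least as long.  If one of them fails, the right side of its step is a power of \<open>X2\<close>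
times a normal monomial with only one factorization: the monomial is longest, but the product is not
(\<open>longest_stable_iff\<close>).
\<close>

no_notation fps_nth (infixl \<open>$\<close> 75)

section \<open>Rings that are the affine line up to nilpotents\<close>

lemma poly_split_power:
  fixes p q :: "'k :: field poly"
  assumes "p \<noteq> 0" "\<not> q dvd 1"
  obtains k r where "p = q ^ k * r" "\<not> q dvd r"
proof -
  have "\<exists>k r. p = q ^ k * r \<and> \<not> q dvd r"
    using assms(1)
  proof (induction "degree p" arbitrary: p rule: less_induct)
    case less
    show ?case
    proof (cases "q dvd p")
      case True
      then obtain s where s: "p = q * s" by blast
      have "q \<noteq> 0" "s \<noteq> 0" using s less.prems by auto
      moreover have "0 < degree q"
        using assms(2) \<open>q \<noteq> 0\<close> by (meson bot_nat_0.not_eq_extremum is_unit_iff_degree)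
      ultimately obtain k r where "s = q ^ k * r" "\<not> q dvd r"
        using less.hyps[of s] s by (auto simp: degree_mult_eq)
      then have "p = q ^ Suc k * r" using s by (simp add: mult.assoc)
      with \<open>\<not> q dvd r\<close> show ?thesis by blast
    next
      case False
      then show ?thesis by (intro exI[of _ 0] exI[of _ p]) simp
    qed
  qed
  then show ?thesis using that by blast
qed

text \<open>
The map \<open>h\<close> identifies the prime ideals of \<open>R\<close> with those of \<open>K[X]\<close>, so heights are those of the
affine line; the nilpotents can only affect depths.
\<close>

locale nilpotent_thickening = cring R for R (structure) +
  fixes h :: "'a \<Rightarrow> 'k :: field poly"
  assumes h_mult: "\<lbrakk>x \<in> carrier R; y \<in> carrier R\<rbrakk> \<Longrightarrow> h (x \<otimes> y) = h x * h y"
    and h_add: "\<lbrakk>x \<in> carrier R; y \<in> carrier R\<rbrakk> \<Longrightarrow> h (x \<oplus> y) = h x + h y"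
    and h_one: "h \<one> = 1"
    and h_surj: "\<exists>x\<in>carrier R. h x = p"
    and nilpotent: "\<lbrakk>x \<in> carrier R; h x = 0\<rbrakk> \<Longrightarrow> \<exists>m::nat. x [^] m = \<zero>"
begin

definition regular_element :: "'a \<Rightarrow> bool" where
  "regular_element x \<longleftrightarrow> x \<in> carrier R \<and> (\<forall>y\<in>carrier R. x \<otimes> y = \<zero> \<longrightarrow> y = \<zero>)"

definition ker :: "'a set" where
  "ker = {x \<in> carrier R. h x = 0}"

text \<open>
The maximal ideal over the point \<open>0\<close> of the affine line.
\<close>

definition origin :: "'a set" where
  "origin = {x \<in> carrier R. [:0, 1:] dvd h x}"

lemma h_zero: "h \<zero> = 0"
  by (metis add_cancel_right_right h_add l_zero zero_closed)

lemma h_minus: "\<lbrakk>x \<in> carrier R; y \<in> carrier R\<rbrakk> \<Longrightarrow> h (x \<ominus> y) = h x - h y"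
  using h_add[of "x \<ominus> y" y] by (simp add: a_minus_def a_assoc l_neg)

lemma h_pow: "x \<in> carrier R \<Longrightarrow> h (x [^] (m::nat)) = h x ^ m"
  by (induction m) (simp_all add: h_one h_mult mult.commute)

lemma lift: obtains x where "x \<in> carrier R" "h x = p"
  using h_surj by blast

lemma minus_add_cancel: "\<lbrakk>x \<in> carrier R; y \<in> carrier R\<rbrakk> \<Longrightarrow> (x \<ominus> y) \<oplus> y = x"
  by (simp add: a_minus_def a_assoc l_neg)

lemma vimage_dvd_ideal: "ideal {x \<in> carrier R. p dvd h x} R"
proof (rule idealI[OF ring_axioms])
  have "p dvd h (\<ominus> x)" if "x \<in> carrier R" "p dvd h x" for x
    using h_minus[of \<zero> x] that by (simp add: h_zero a_minus_def)
  then show "subgroup {x \<in> carrier R. p dvd h x} (add_monoid R)"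
    by (intro subgroup.intro) (auto simp: h_add h_zero a_inv_def[symmetric])
qed (auto simp: h_mult)

lemma ker_ideal: "ideal ker R"
  using vimage_dvd_ideal[of 0] by (simp add: ker_def)

lemma ker_prime: "primeideal ker R"
proof (rule primeidealI[OF ker_ideal is_cring])
  have "\<one> \<notin> ker" using h_one by (simp add: ker_def)
  then show "carrier R \<noteq> ker" using one_closed by blast
qed (auto simp: ker_def h_mult)

lemma prime_pow:
  assumes "primeideal P R" "x \<in> carrier R" "x [^] (m::nat) \<in> P"
  shows "x \<in> P"
proof -
  interpret primeideal P R by fact
  show ?thesis using assms(3)
  proof (induction m)
    case 0
    then show ?case using I_notcarr one_imp_carrier by simp
  next
    case (Suc m)
    then show ?case using I_prime[of "x [^] m" x] assms(2) by auto
  qed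
qed

lemma ker_subset_prime: "primeideal P R \<Longrightarrow> ker \<subseteq> P"
proof
  fix x assume P: "primeideal P R" and "x \<in> ker"
  then obtain m :: nat where "x \<in> carrier R" "x [^] m = \<zero>"
    using nilpotent by (auto simp: ker_def)
  then show "x \<in> P"
    using prime_pow[OF P] additive_subgroup.zero_closed ideal.axioms(1) primeideal.axioms(1) P by metis
qed

lemma mem_ideal_if_same_image:
  assumes "ideal I R" "ker \<subseteq> I" "x \<in> carrier R" "y \<in> I" "h x = h y"
  shows "x \<in> I"
proof -
  interpret ideal I R by fact
  have y: "y \<in> carrier R" using assms(4) by (rule Icarr)
  then have "x \<ominus> y \<in> ker" using assms(3,5) by (simp add: ker_def h_minus)
  then have "(x \<ominus> y) \<oplus> y \<in> I" using assms(2,4) by blast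
  then show ?thesis using minus_add_cancel assms(3) y by simp
qed

text \<open>
Division with remainder by a polynomial of least degree in the image of \<open>I\<close>; the quotient has to be
lifted to \<open>R\<close> so that the remainder is again the image of an element of \<open>I\<close>.
\<close>

lemma image_generator:
  assumes "ideal I R" "I \<noteq> ker" "ker \<subseteq> I"
  obtains g where "g \<in> I" "h g \<noteq> 0" "\<And>x. x \<in> carrier R \<Longrightarrow> x \<in> I \<longleftrightarrow> h g dvd h x"
proof -
  interpret ideal I R by fact
  obtain x where "x \<in> I" "x \<notin> ker" using assms(2,3) by blast
  then have "x \<in> I \<and> h x \<noteq> 0" using Icarr[of x] unfolding ker_def by blast
  then have "\<exists>g. (g \<in> I \<and> h g \<noteq> 0) \<and>
      (\<forall>x. x \<in> I \<and> h x \<noteq> 0 \<longrightarrow> degree (h g) \<le> degree (h x))"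
    by (rule ex_has_least_nat)
  then obtain g where g: "g \<in> I" "h g \<noteq> 0"
    and least: "\<And>x. \<lbrakk>x \<in> I; h x \<noteq> 0\<rbrakk> \<Longrightarrow> degree (h g) \<le> degree (h x)"
    by blast
  have gc: "g \<in> carrier R" using g by (simp add: Icarr)
  have "h g dvd h x" if x: "x \<in> I" for x
  proof -
    obtain q where q: "q \<in> carrier R" "h q = h x div h g" by (rule lift)
    have xc: "x \<in> carrier R" using x by (rule Icarr)
    have "x \<ominus> q \<otimes> g \<in> I"
      using x g q by (simp add: a_minus_def I_l_closed)
    moreover have "h (x \<ominus> q \<otimes> g) = h x mod h g"
      using q xc gc by (simp add: h_minus h_mult minus_div_mult_eq_mod)
    ultimately have "h x mod h g = 0"
      using least degree_mod_less[OF g(2), of "h x"] by force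
    then show ?thesis by (simp add: dvd_eq_mod_eq_0)
  qed
  moreover have "x \<in> I" if x: "x \<in> carrier R" "h g dvd h x" for x
  proof -
    obtain q where q: "q \<in> carrier R" "h x = h g * h q" using x(2) lift by (metis dvdE)
    then show ?thesis
      using mem_ideal_if_same_image[OF assms(1,3) x(1), of "q \<otimes> g"] g gc I_l_closed
      by (simp add: h_mult mult.commute)
  qed
  ultimately show ?thesis using that g by blast
qed

text \<open>
Let \<open>g\<close> and \<open>f\<close> generate the images of \<open>P\<close> and \<open>Q\<close>.  Then \<open>g\<close> is a multiple of \<open>f\<close>, and \<open>P\<close>, being
prime, contains \<open>f\<close> or the cofactor.  The first makes \<open>P\<close> and \<open>Q\<close> equal, the second makes \<open>f\<close> a unit.
\<close>

lemma no_prime_above: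
  assumes P: "primeideal P R" "P \<noteq> ker" and Q: "primeideal Q R" and PQ: "P \<subset> Q"
  shows False
proof -
  interpret P: primeideal P R by fact
  interpret Q: primeideal Q R by fact
  note kP = ker_subset_prime[OF P(1)] and kQ = ker_subset_prime[OF Q]
  obtain g where g: "g \<in> P" "h g \<noteq> 0" "\<And>x. x \<in> carrier R \<Longrightarrow> x \<in> P \<longleftrightarrow> h g dvd h x"
    using image_generator[OF P.ideal_axioms P(2) kP] by blast
  have Qk: "Q \<noteq> ker" using PQ kP by blast
  obtain f where f: "f \<in> Q" "h f \<noteq> 0" "\<And>x. x \<in> carrier R \<Longrightarrow> x \<in> Q \<longleftrightarrow> h f dvd h x"
    using image_generator[OF Q.ideal_axioms Qk kQ] by blast
  have gc: "g \<in> carrier R" and fc: "f \<in> carrier R"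
    using P.Icarr[OF g(1)] Q.Icarr[OF f(1)] by auto
  have "h f dvd h g" using f(3) gc g(1) PQ by blast
  then obtain s where s: "s \<in> carrier R" "h g = h f * h s" using lift by (metis dvdE)
  then have "f \<otimes> s \<in> P" using g(3) fc by (simp add: h_mult)
  then consider "f \<in> P" | "s \<in> P" using P.I_prime fc s(1) by blast
  then show False
  proof cases
    case 1
    then have "h g dvd h f" using g(3) fc by simp
    then have "x \<in> P" if "x \<in> Q" for x
      using that f(3) g(3) Q.Icarr[OF that] dvd_trans by blast
    with PQ show False by blast
  next
    case 2
    then have "h f * h s dvd h s" using g(3) s by simp
    then have "h f dvd 1" using s g(2) by (simp add: dvd_mult_cancel_right)
    then have "\<one> \<in> Q" using f(3) h_one by simp
    then show False using Q.one_imp_carrier Q.I_notcarr by simp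
  qed
qed

lemma origin_maximal: "maximalideal origin R"
proof (rule maximalidealI)
  show id: "ideal origin R" unfolding origin_def by (rule vimage_dvd_ideal)
  have "\<one> \<notin> origin" by (simp add: origin_def h_one is_unit_iff_degree)
  then show "carrier R \<noteq> origin" using one_closed by blast
  fix J assume J: "ideal J R" "origin \<subseteq> J" "J \<subseteq> carrier R"
  interpret J: ideal J R by fact
  show "J = origin \<or> J = carrier R"
  proof (rule ccontr)
    assume *: "\<not> (J = origin \<or> J = carrier R)"
    then obtain y where y: "y \<in> J" "y \<notin> origin" using J(2) by blast
    have yc: "y \<in> carrier R" using y by (simp add: J.Icarr)
    define c where "c = poly (h y) 0"
    have c: "c \<noteq> 0" using y(2) yc by (simp add: origin_def c_def poly_eq_0_iff_dvd)
    obtain u where u: "u \<in> carrier R" "h u = [:inverse c:]" by (rule lift)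
    have "poly (h (\<one> \<ominus> u \<otimes> y)) 0 = 0"
      using u yc c by (simp add: h_minus h_mult h_one c_def)
    then have "\<one> \<ominus> u \<otimes> y \<in> J"
      using J(2) u yc by (auto simp: origin_def poly_eq_0_iff_dvd)
    then have "(\<one> \<ominus> u \<otimes> y) \<oplus> u \<otimes> y \<in> J"
      using y u by (simp add: J.I_l_closed)
    then have "\<one> \<in> J" using minus_add_cancel u yc by simp
    then show False using * J.one_imp_carrier by simp
  qed
qed

lemma maximal_not_ker:
  assumes M: "maximalideal M R"
  shows "M \<noteq> ker"
proof
  obtain t where "t \<in> carrier R" "h t = [:0, 1:]" by (rule lift)
  then have t: "t \<in> origin" "t \<notin> ker" by (simp_all add: ker_def origin_def)
  interpret M: maximalideal M R by fact
  interpret O: maximalideal origin R by (rule origin_maximal)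
  assume Mk: "M = ker"
  have "M \<subseteq> origin" unfolding Mk ker_def origin_def by auto
  then have eq: "origin = M"
    using M.I_maximal[OF O.ideal_axioms] O.I_notcarr O.a_subset by blast
  with t Mk show False by blast
qed

lemma height_maximal:
  assumes M: "maximalideal M R"
  shows "prime_height R M = 1"
proof -
  define K where
    "K = {k. \<exists>c. (\<forall>i\<le>k. primeideal (c i) R) \<and> (\<forall>i<k. c i \<subset> c (Suc i)) \<and> c k = M}"
  have "ker \<subset> M"
    using ker_subset_prime[OF maximalideal_prime[OF M]] maximal_not_ker[OF M] by blast
  then have "1 \<in> K"
    unfolding K_def using maximalideal_prime[OF M] ker_prime
    by (intro CollectI exI[of _ "\<lambda>i. if i = 0 then ker else M"]) simp
  then have "enat 1 \<le> (SUP k\<in>K. enat k)" by (rule SUP_upper)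
  moreover have "k \<le> 1" if k: "k \<in> K" for k
  proof (rule ccontr)
    assume "\<not> k \<le> 1"
    then have "k = Suc (Suc (k - 2))" by simp
    then obtain j where j: "k = Suc (Suc j)" by blast
    from k obtain c where c: "\<forall>i\<le>k. primeideal (c i) R" "\<forall>i<k. c i \<subset> c (Suc i)"
      unfolding K_def by blast
    have "ker \<subseteq> c j" using c(1) j by (intro ker_subset_prime) simp
    moreover have "c j \<subset> c (Suc j)" using c(2) j by simp
    ultimately have "c (Suc j) \<noteq> ker" by blast
    moreover have "primeideal (c (Suc j)) R" "primeideal (c (Suc (Suc j))) R" using c(1) j by simp_all
    moreover have "c (Suc j) \<subset> c (Suc (Suc j))" using c(2) j by simp
    ultimately show False using no_prime_above by blast
  qed
  then have "(SUP k\<in>K. enat k) \<le> enat 1"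
    by (intro SUP_least) simp
  ultimately have "(SUP k\<in>K. enat k) = enat 1" by (rule antisym[rotated])
  then show ?thesis unfolding prime_height_def K_def one_enat_def .
qed

lemma Idl_empty: "Idl {} = {\<zero>}"
proof -
  have "Idl {} \<subseteq> {\<zero>}" by (rule genideal_minimal[OF zeroideal]) simp
  moreover have "ideal (Idl {}) R" by (rule genideal_ideal) simp
  then have "\<zero> \<in> Idl {}" by (rule additive_subgroup.zero_closed[OF ideal.axioms(1)])
  ultimately show ?thesis by blast
qed

lemma regular_sequence_hd:
  assumes "regular_sequence R xs" "xs \<noteq> []"
  shows "regular_element (xs ! 0)"
proof -
  have len: "0 < length xs" using assms(2) by simp
  have "set xs \<subseteq> carrier R" and reg: "\<forall>y\<in>carrier R. xs ! 0 \<otimes> y \<in> Idl (set (take 0 xs)) \<longrightarrow> y \<in> Idl (set (take 0 xs))"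
    using assms(1) len unfolding regular_sequence_def by blast+
  moreover have "xs ! 0 \<in> set xs" using len by (rule nth_mem)
  ultimately show ?thesis unfolding regular_element_def by (simp add: Idl_empty subset_iff)
qed

lemma regular_element_pow:
  assumes "regular_element a" "y \<in> carrier R" "a [^] (m::nat) \<otimes> y = \<zero>"
  shows "y = \<zero>"
  using assms(3)
proof (induction m)
  case 0
  then show ?case using assms(2) by simp
next
  case (Suc m)
  have a: "a \<in> carrier R" using assms(1) by (simp add: regular_element_def)
  have "a \<otimes> (a [^] m \<otimes> y) = \<zero>"
    using Suc.prems a assms(2) by (simp add: m_ac)
  moreover have "a [^] m \<otimes> y \<in> carrier R" using a assms(2) by simp
  ultimately have "a [^] m \<otimes> y = \<zero>" using assms(1) unfolding regular_element_def by blast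
  then show ?case by (rule Suc.IH)
qed

text \<open>
Let \<open>g\<close> generate the image of \<open>M\<close>, and let the image of \<open>a\<close> be \<open>g ^ k * r\<close> with \<open>r\<close> not divisible by \<open>g\<close>.
As \<open>g\<close> divides the image of \<open>b\<close>, the product of \<open>b [^] k\<close> with a lift \<open>r'\<close> of \<open>r\<close> is a multiple of \<open>a\<close> up
to a nilpotent, so a power of it lies in the ideal of \<open>a\<close>.  Cancelling \<open>b\<close> leaves a power of \<open>r'\<close> in
\<open>M\<close>, although \<open>g\<close> does not divide \<open>r\<close>.
\<close>

lemma no_regular_pair:
  assumes M: "maximalideal M R" and ab: "a \<in> M" "b \<in> M" and a: "regular_element a"
    and b: "\<And>y. \<lbrakk>y \<in> carrier R; b \<otimes> y \<in> PIdl a\<rbrakk> \<Longrightarrow> y \<in> PIdl a"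
  shows False
proof -
  interpret M: maximalideal M R by fact
  note prime = maximalideal_prime[OF M] and kM = ker_subset_prime[OF maximalideal_prime[OF M]]
  have ac: "a \<in> carrier R" and bc: "b \<in> carrier R" using M.Icarr[OF ab(1)] M.Icarr[OF ab(2)] by auto
  interpret I: ideal "PIdl a" R using ac by (rule cgenideal_ideal)
  have IM: "PIdl a \<subseteq> M" using M.ideal_axioms ab(1) by (rule cgenideal_minimal)
  have M1: "\<one> \<notin> M" using M.one_imp_carrier M.I_notcarr by auto
  obtain g where g: "g \<in> M" "h g \<noteq> 0" "\<And>x. x \<in> carrier R \<Longrightarrow> x \<in> M \<longleftrightarrow> h g dvd h x"
    using image_generator[OF M.ideal_axioms maximal_not_ker[OF M] kM] by blast
  have "\<not> h g dvd 1" using g(3)[of \<one>] M1 h_one by simp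
  moreover have "h a \<noteq> 0"
  proof
    assume "h a = 0"
    then obtain m :: nat where "a [^] m = \<zero>" using nilpotent ac by blast
    then have "\<one> = \<zero>" using regular_element_pow[OF a, of \<one> m] by simp
    then show False using M1 M.zero_closed by simp
  qed
  ultimately obtain k r where r: "h a = h g ^ k * r" "\<not> h g dvd r"
    using poly_split_power by blast
  obtain q where q: "h b = h g * q" using g(3)[OF bc] ab by blast
  obtain r' where r': "r' \<in> carrier R" "h r' = r" by (rule lift)
  obtain c where c: "c \<in> carrier R" "h c = q ^ k" by (rule lift)
  define y where "y = b [^] k \<otimes> r'"
  have yc: "y \<in> carrier R" using bc r' by (simp add: y_def)
  have "h (y \<ominus> c \<otimes> a) = 0"
    using r q r' c ac bc yc by (simp add: h_minus h_mult y_def h_pow power_mult_distrib)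
  then obtain m :: nat where m: "(y \<ominus> c \<otimes> a) [^] m = \<zero>"
    using nilpotent c ac yc by (metis m_closed minus_closed)
  have caI: "c \<otimes> a \<in> PIdl a" using c cgenideal_self[OF ac] I.I_l_closed by blast
  \<comment> \<open>\<open>y\<close> and \<open>y \<ominus> c \<otimes> a\<close> are congruent modulo the ideal of \<open>a\<close>, hence so are their powers.\<close>
  have "\<exists>z\<in>PIdl a. y [^] i = (y \<ominus> c \<otimes> a) [^] i \<oplus> z" for i :: nat
  proof (induction i)
    case 0
    then show ?case using I.zero_closed by (intro bexI[of _ \<zero>]) auto
  next
    case (Suc i)
    then obtain z where z: "z \<in> PIdl a" "y [^] i = (y \<ominus> c \<otimes> a) [^] i \<oplus> z" by blast
    define w where "w = y \<ominus> c \<otimes> a"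
    have wc: "w \<in> carrier R" "z \<in> carrier R" "c \<otimes> a \<in> carrier R"
      using yc c ac I.Icarr[OF z(1)] by (auto simp: w_def)
    have yw: "y = w \<oplus> c \<otimes> a" unfolding w_def by (rule minus_add_cancel[symmetric, OF yc wc(3)])
    have "y [^] i = w [^] i \<oplus> z" unfolding w_def by (rule z(2))
    then have "y [^] i \<otimes> y = (w [^] i \<oplus> z) \<otimes> (w \<oplus> c \<otimes> a)"
      using yw by (rule arg_cong2[where f = "(\<otimes>)"])
    then have "y [^] Suc i = (w [^] i \<oplus> z) \<otimes> (w \<oplus> c \<otimes> a)" by simp
    also have "\<dots> = w [^] Suc i \<oplus> (w [^] i \<otimes> (c \<otimes> a) \<oplus> z \<otimes> (w \<oplus> c \<otimes> a))"
      using wc by (simp add: l_distr r_distr a_ac)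
    finally have "y [^] Suc i = w [^] Suc i \<oplus> (w [^] i \<otimes> (c \<otimes> a) \<oplus> z \<otimes> (w \<oplus> c \<otimes> a))" .
    moreover have "w [^] i \<otimes> (c \<otimes> a) \<oplus> z \<otimes> (w \<oplus> c \<otimes> a) \<in> PIdl a"
      using wc by (intro I.a_closed I.I_l_closed[OF caI] I.I_r_closed[OF z(1)]) simp_all
    ultimately show ?case unfolding w_def[symmetric] by blast
  qed
  then obtain z where z: "z \<in> PIdl a" "y [^] m = \<zero> \<oplus> z" using m by metis
  then have "y [^] m \<in> PIdl a" using I.Icarr[OF z(1)] by simp
  then have "b [^] (k * m) \<otimes> r' [^] m \<in> PIdl a"
    using bc r' by (simp add: y_def nat_pow_distrib nat_pow_pow)
  moreover have "v \<in> PIdl a" if "b [^] j \<otimes> v \<in> PIdl a" "v \<in> carrier R" for j :: nat and v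
    using that(1)
  proof (induction j)
    case 0
    then show ?case using that(2) by simp
  next
    case (Suc j)
    then have "b \<otimes> (b [^] j \<otimes> v) \<in> PIdl a"
      using bc that(2) by (simp add: m_ac)
    moreover have "b [^] j \<otimes> v \<in> carrier R" using bc that(2) by simp
    ultimately show ?case using Suc.IH b by blast
  qed
  ultimately have "r' [^] m \<in> PIdl a" using r' by simp
  then have "r' \<in> M" using prime_pow[OF prime r'(1)] IM by blast
  then show False using g(3) r' r(2) by simp
qed

lemma depth_maximal_le:
  assumes M: "maximalideal M R"
  shows "ideal_depth R M \<le> 1"
  unfolding ideal_depth_def
proof (rule SUP_least)
  fix xs assume "xs \<in> {xs. set xs \<subseteq> M \<and> regular_sequence R xs}"
  then have xs: "set xs \<subseteq> M" "regular_sequence R xs" by auto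
  have "\<not> 2 \<le> length xs"
  proof
    assume len: "2 \<le> length xs"
    then obtain a b ys where ys: "xs = a # b # ys"
      by (metis One_nat_def Suc_1 Suc_le_length_iff)
    have ac: "a \<in> carrier R" using xs(2) ys by (simp add: regular_sequence_def)
    have "y \<in> PIdl a" if "y \<in> carrier R" "b \<otimes> y \<in> PIdl a" for y
    proof -
      have "\<forall>y\<in>carrier R. xs ! 1 \<otimes> y \<in> Idl (set (take 1 xs)) \<longrightarrow> y \<in> Idl (set (take 1 xs))"
        using xs(2) len unfolding regular_sequence_def by auto
      with that show ?thesis by (simp add: ys cgenideal_eq_genideal[OF ac])
    qed
    moreover have "regular_element a" using regular_sequence_hd[OF xs(2)] ys by simp
    ultimately show False using no_regular_pair[OF M, of a b] xs(1) ys by auto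
  qed
  then have "length xs \<le> 1" by linarith
  then show "enat (length xs) \<le> 1" unfolding one_enat_def by (simp only: enat_ord_simps)
qed

text \<open>
A maximal ideal contains an element with nonzero image.  Membership depends on the image only, so
the regular lift of that image belongs to the ideal as well.
\<close>

lemma cohen_macaulayI:
  assumes noeth: "noetherian_ring R"
    and reg: "\<And>p. p \<noteq> 0 \<Longrightarrow> \<exists>a. regular_element a \<and> h a = p"
  shows "cohen_macaulay R"
  unfolding cohen_macaulay_def
proof (intro conjI allI impI noeth is_cring)
  fix M assume M: "maximalideal M R"
  interpret M: maximalideal M R by fact
  note kM = ker_subset_prime[OF maximalideal_prime[OF M]]
  obtain g where g: "g \<in> M" "h g \<noteq> 0"
    using image_generator[OF M.ideal_axioms maximal_not_ker[OF M] kM] by blast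
  obtain a where a: "regular_element a" "h a = h g" using reg g by blast
  have ac: "a \<in> carrier R" using a by (simp add: regular_element_def)
  have aM: "a \<in> M" using mem_ideal_if_same_image[OF M.ideal_axioms kM ac g(1)] a by simp
  have "Idl {a} \<subseteq> M" using aM M.ideal_axioms by (intro genideal_minimal) auto
  then have "Idl {a} \<noteq> carrier R" using M.I_notcarr M.a_subset by blast
  then have "regular_sequence R [a]"
    using a ac by (auto simp: regular_sequence_def regular_element_def Idl_empty)
  then have "[a] \<in> {xs. set xs \<subseteq> M \<and> regular_sequence R xs}" using aM by simp
  then have "enat (length [a]) \<le> ideal_depth R M" unfolding ideal_depth_def by (rule SUP_upper)
  then have "1 \<le> ideal_depth R M" by (simp add: one_enat_def)
  then show "ideal_depth R M = prime_height R M"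
    using depth_maximal_le[OF M] height_maximal[OF M] by simp
qed

text \<open>
Depth one at the origin supplies a regular element \<open>a\<close> whose image is divisible by \<open>X\<close>, that is,
\<open>a = t q + w\<close> with \<open>w\<close> nilpotent.  On elements annihilated by \<open>t\<close> the powers of \<open>a\<close> act like those of
\<open>w\<close>, hence eventually as zero.
\<close>

lemma cohen_macaulay_imp_regular:
  assumes cm: "cohen_macaulay R" and t: "t \<in> carrier R" "h t = [:0, 1:]"
  shows "regular_element t"
proof -
  have "ideal_depth R origin = 1"
    using cm origin_maximal height_maximal by (simp add: cohen_macaulay_def)
  then have "\<exists>xs. set xs \<subseteq> origin \<and> regular_sequence R xs \<and> xs \<noteq> []"
    unfolding ideal_depth_def
    by (metis (mono_tags, lifting) SUP_least list.size(3) mem_Collect_eq not_one_le_zero order_refl zero_enat_def)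
  then obtain xs where xs: "set xs \<subseteq> origin" "regular_sequence R xs" "xs \<noteq> []" by blast
  define a where "a = xs ! 0"
  have a: "regular_element a" "a \<in> origin"
    using regular_sequence_hd xs by (auto simp: a_def)
  have ac: "a \<in> carrier R" using a by (simp add: regular_element_def)
  obtain q where q: "q \<in> carrier R" "h a = [:0, 1:] * h q"
    using a(2) lift unfolding origin_def by (metis (mono_tags, lifting) dvdE mem_Collect_eq)
  define w where "w = a \<ominus> t \<otimes> q"
  have wc: "w \<in> carrier R" using ac t q by (simp add: w_def)
  have "h w = 0" using ac t q by (simp add: w_def h_minus h_mult)
  then obtain m :: nat where m: "w [^] m = \<zero>" using nilpotent wc by blast
  have "y = \<zero>" if y: "y \<in> carrier R" "t \<otimes> y = \<zero>" for y
  proof -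
    have "a = w \<oplus> t \<otimes> q" using minus_add_cancel ac t q by (simp add: w_def)
    then have "a \<otimes> y = (w \<oplus> t \<otimes> q) \<otimes> y" by simp
    also have "\<dots> = w \<otimes> y \<oplus> (t \<otimes> q) \<otimes> y" using wc t(1) q(1) y(1) by (simp add: l_distr)
    also have "(t \<otimes> q) \<otimes> y = q \<otimes> (t \<otimes> y)" using t(1) q(1) y(1) by (simp add: m_ac)
    finally have "a \<otimes> y = w \<otimes> y \<oplus> q \<otimes> (t \<otimes> y)" .
    then have awy: "a \<otimes> y = w \<otimes> y" using y q wc by simp
    have "a [^] i \<otimes> y = w [^] i \<otimes> y" for i :: nat
    proof (induction i)
      case (Suc i)
      have "a [^] Suc i \<otimes> y = a [^] i \<otimes> (w \<otimes> y)"
        using awy ac y by (simp add: m_assoc)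
      also have "\<dots> = w \<otimes> (a [^] i \<otimes> y)" using ac wc y by (simp add: m_ac)
      also have "\<dots> = w [^] Suc i \<otimes> y" using Suc wc y by (simp add: m_ac)
      finally show ?case .
    qed simp
    then have "a [^] m \<otimes> y = \<zero>" using m y by simp
    then show ?thesis using regular_element_pow a(1) y(1) by blast
  qed
  then show ?thesis using t by (simp add: regular_element_def)
qed

end

section \<open>The tangent cone ideal in terms of weights and lengths\<close>

lemma poly_mapping_induct_single [case_names zero single add]:
  fixes f :: "'a \<Rightarrow>\<^sub>0 'b :: comm_monoid_add"
  assumes "P 0" "\<And>e c. P (Poly_Mapping.single e c)" "\<And>f g. \<lbrakk>P f; P g\<rbrakk> \<Longrightarrow> P (f + g)"
  shows "P f"
proof (induction f rule: update_induct)
  case const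
  show ?case by (rule assms(1))
next
  case (update f a b)
  then have "Poly_Mapping.update a b f = f + Poly_Mapping.single a b"
    by (intro poly_mapping_eqI) (auto simp: lookup_update lookup_add lookup_single in_keys_iff when_def)
  then show ?case using update assms(2,3) by simp
qed

text \<open>
The \<open>K\<close>-linear extension of a map given on monomials.
\<close>

definition lin_ext :: "('a \<Rightarrow> 'k :: field poly) \<Rightarrow> ('a \<Rightarrow>\<^sub>0 'k) \<Rightarrow> 'k poly" where
  "lin_ext \<psi> f = (\<Sum>e\<in>Poly_Mapping.keys f. smult (Poly_Mapping.lookup f e) (\<psi> e))"

lemma lin_ext_zero [simp]: "lin_ext \<psi> 0 = 0"
  by (simp add: lin_ext_def)

lemma lin_ext_single [simp]: "lin_ext \<psi> (Poly_Mapping.single e c) = smult c (\<psi> e)"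
  by (simp add: lin_ext_def)

lemma lin_ext_add: "lin_ext \<psi> (f + g) = lin_ext \<psi> f + lin_ext \<psi> g"
  unfolding lin_ext_def by (rule setsum_keys_plus_distrib) (simp_all add: smult_add_left)

lemma lin_ext_diff: "lin_ext \<psi> (f - g) = lin_ext \<psi> f - lin_ext \<psi> g"
  using lin_ext_add[of \<psi> "f - g" g] by simp

lemma lin_ext_fun_mult: "lin_ext (\<lambda>e. q * \<psi> e) f = q * lin_ext \<psi> f"
  by (simp add: lin_ext_def sum_distrib_left)

lemma lin_ext_single_mult:
  "lin_ext \<psi> (Poly_Mapping.single d c * f) = smult c (lin_ext (\<lambda>e. \<psi> (d + e)) f)"
  by (induction f rule: poly_mapping_induct_single)
    (simp_all add: mult_single lin_ext_add distrib_left smult_add_right)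

lemma lin_ext_mult:
  assumes "\<And>d e. \<psi> (d + e) = \<psi> d * \<psi> e"
  shows "lin_ext \<psi> (f * g) = lin_ext \<psi> f * lin_ext \<psi> g"
  by (induction f rule: poly_mapping_induct_single)
    (simp_all add: lin_ext_single_mult assms lin_ext_fun_mult lin_ext_add distrib_right)

lemma coeff_lin:
  "coeff (lin_ext \<psi> f) s = (\<Sum>e\<in>Poly_Mapping.keys f. Poly_Mapping.lookup f e * coeff (\<psi> e) s)"
  by (simp add: lin_ext_def coeff_sum)

lemma coeff_lin_monom:
  "coeff (lin_ext (\<lambda>e. if P e then Polynomial.monom 1 (w e) else 0) f) s =
     (\<Sum>e\<in>{e \<in> Poly_Mapping.keys f. P e \<and> w e = s}. Poly_Mapping.lookup f e)"
  unfolding coeff_lin by (intro sum.mono_neutral_cong_right) auto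

definition weight :: "nat ^ 4 \<Rightarrow> nat ^ 4 \<Rightarrow> nat" where
  "weight n e = (\<Sum>i\<in>UNIV. e $ i * n $ i)"

text \<open>
For a longest \<open>e\<close> the monomial \<open>X^e\<close> has degree equal to the order of \<open>t ^ weight n e\<close> in the local ring,
so that it does not vanish in the associated graded ring.
\<close>

definition longest :: "nat ^ 4 \<Rightarrow> nat ^ 4 \<Rightarrow> bool" where
  "longest n e \<longleftrightarrow> (\<forall>f. weight n f = weight n e \<longrightarrow> total_degree f \<le> total_degree e)"

text \<open>
The class of a polynomial in the tangent cone ring, written in the basis of that ring that the
semigroup indexes; \<open>t ^ s\<close> only serves as a name for the basis vector of \<open>s\<close>, and the map is not
multiplicative.
\<close>

definition weight_map :: "nat ^ 4 \<Rightarrow> 'k :: field poly4 \<Rightarrow> 'k poly" where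
  "weight_map n = lin_ext (\<lambda>e. if longest n e then Polynomial.monom 1 (weight n e) else 0)"

lemma weight_add: "weight n (d + e) = weight n d + weight n e"
  by (simp add: weight_def sum.distrib algebra_simps)

lemma total_degree_add: "total_degree (d + e) = total_degree d + total_degree e"
  by (simp add: total_degree_def sum.distrib)

lemma longest_cancel: "longest n (d + e) \<Longrightarrow> longest n e"
  unfolding longest_def
  by (metis weight_add total_degree_add nat_add_left_cancel_le)

lemma longest_same:
  assumes "longest n e" "longest n f" "weight n e = weight n f"
  shows "total_degree e = total_degree f"
  using assms unfolding longest_def by (metis le_antisym)

lemma longest_cong:
  "\<lbrakk>weight n e = weight n f; total_degree e = total_degree f\<rbrakk> \<Longrightarrow> longest n e \<longleftrightarrow> longest n f"
  by (simp add: longest_def)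

lemma coeff_weight_map:
  "coeff (weight_map n f) s =
     (\<Sum>e\<in>{e \<in> Poly_Mapping.keys f. longest n e \<and> weight n e = s}. Poly_Mapping.lookup f e)"
  by (simp add: weight_map_def coeff_lin_monom)

lemma weight_map_add: "weight_map n (f + g) = weight_map n f + weight_map n g"
  by (simp add: weight_map_def lin_ext_add)

lemma weight_map_diff: "weight_map n (f - g) = weight_map n f - weight_map n g"
  by (simp add: weight_map_def lin_ext_diff)

lemma weight_map_single:
  "weight_map n (Poly_Mapping.single e c) = (if longest n e then Polynomial.monom c (weight n e) else 0)"
  by (simp add: weight_map_def smult_monom)

lemma weight_map_zero [simp]: "weight_map n 0 = 0"
  by (simp add: weight_map_def)

text \<open>
Multiplication by \<open>X^d\<close> respects weights.  Longest exponent vectors of the same weight have the same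
degree, so for longest \<open>e\<close> it depends on the weight of \<open>e\<close> alone whether \<open>d + e\<close> is longest: on the part
of weight \<open>s\<close>, multiplication by \<open>X^d\<close> either kills everything or just shifts the coefficient.
\<close>

lemma weight_map_mult_zero:
  assumes "weight_map n f = 0"
  shows "weight_map n (g * f) = 0"
proof (induction g rule: poly_mapping_induct_single)
  case (single d c)
  let ?\<psi> = "\<lambda>e. if longest n (d + e) then Polynomial.monom (1 :: 'a) (weight n (d + e)) else 0"
  have "coeff (lin_ext ?\<psi> f) s = 0" for s
  proof (cases "\<exists>e. longest n (d + e) \<and> weight n (d + e) = s")
    case False
    then show ?thesis unfolding coeff_lin_monom[of "\<lambda>e. longest n (d + e)"] by (intro sum.neutral) auto
  next
    case True
    then obtain e0 where e0: "longest n (d + e0)" "weight n (d + e0) = s" by blast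
    have "longest n (d + e) \<and> weight n (d + e) = s \<longleftrightarrow> longest n e \<and> weight n e = weight n e0" for e
    proof
      assume "longest n (d + e) \<and> weight n (d + e) = s"
      then show "longest n e \<and> weight n e = weight n e0"
        using e0 longest_cancel[of n d e] by (simp add: weight_add)
    next
      assume e: "longest n e \<and> weight n e = weight n e0"
      then have "total_degree e = total_degree e0"
        using longest_same longest_cancel[OF e0(1)] by blast
      then have "longest n (d + e) \<longleftrightarrow> longest n (d + e0)"
        using e by (intro longest_cong) (simp_all add: weight_add total_degree_add)
      then show "longest n (d + e) \<and> weight n (d + e) = s"
        using e e0 by (simp add: weight_add)
    qed
    then show ?thesis
      unfolding coeff_lin_monom[of "\<lambda>e. longest n (d + e)"]
      using coeff_weight_map[of n f "weight n e0"] assms by simp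
  qed
  then have "lin_ext ?\<psi> f = 0" by (intro poly_eqI) simp
  then show ?case by (simp add: weight_map_def lin_ext_single_mult)
qed (simp_all add: distrib_right weight_map_add)


lemma poly4_cring: "cring (poly4_ring :: 'k :: field poly4 ring)"
  by (rule cring_from_type_algebra)

lemma poly4_ring_simps [simp]:
  "carrier (poly4_ring :: 'k :: field poly4 ring) = UNIV"
  "f \<otimes>\<^bsub>poly4_ring\<^esub> g = f * (g :: 'k poly4)"
  "f \<oplus>\<^bsub>poly4_ring\<^esub> g = f + (g :: 'k poly4)"
  "\<zero>\<^bsub>poly4_ring\<^esub> = (0 :: 'k poly4)"
  "\<one>\<^bsub>poly4_ring\<^esub> = (1 :: 'k poly4)"
  by (simp_all add: ring_of_type_algebra_def)

lemma poly4_ring_minus: "\<ominus>\<^bsub>poly4_ring\<^esub> f = - (f :: 'k :: field poly4)"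
proof -
  interpret cring "poly4_ring :: 'k poly4 ring" by (rule poly4_cring)
  show ?thesis using minus_equality[of "- f" f] by simp
qed

lemma ideal_poly4I:
  fixes I :: "'k :: field poly4 set"
  assumes "0 \<in> I" "\<And>f g. \<lbrakk>f \<in> I; g \<in> I\<rbrakk> \<Longrightarrow> f + g \<in> I" "\<And>f g. f \<in> I \<Longrightarrow> g * f \<in> I"
  shows "ideal I poly4_ring"
proof -
  interpret cring "poly4_ring :: 'k poly4 ring" by (rule poly4_cring)
  have "- f \<in> I" if "f \<in> I" for f using assms(3)[OF that, of "- 1"] by simp
  then show ?thesis
    using assms by (intro idealI[OF ring_axioms] add.subgroupI)
      (auto simp: poly4_ring_minus mult.commute)
qed

lemma ideal_poly4D:
  fixes I :: "'k :: field poly4 set"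
  assumes "ideal I poly4_ring"
  shows "0 \<in> I" "\<lbrakk>f \<in> I; g \<in> I\<rbrakk> \<Longrightarrow> f + g \<in> I" "f \<in> I \<Longrightarrow> g * f \<in> I"
    "\<lbrakk>f \<in> I; g \<in> I\<rbrakk> \<Longrightarrow> f - g \<in> I"
proof -
  interpret ideal I poly4_ring by fact
  note add_sub = ideal.axioms(1)[OF assms]
  show "0 \<in> I" using additive_subgroup.zero_closed[OF add_sub] by simp
  show "f + g \<in> I" if "f \<in> I" "g \<in> I" for f g
    using additive_subgroup.a_closed[OF add_sub that] by simp
  then have add: "f + g \<in> I" if "f \<in> I" "g \<in> I" for f g using that .
  show mult: "g * f \<in> I" if "f \<in> I" for f g using I_l_closed[OF that, of g] by simp
  show "f - g \<in> I" if "f \<in> I" "g \<in> I" for f g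
    using add[OF that(1) mult[OF that(2), of "- 1"]] by simp
qed

lemma tangent_cone_ideal_is_ideal: "ideal (tangent_cone_ideal n) poly4_ring"
  unfolding tangent_cone_ideal_def
  by (rule ring.genideal_ideal) (auto intro: cring.axioms(1)[OF poly4_cring])

lemma initial_form_in_tangent_cone_ideal:
  assumes "f \<in> curve_ideal n" "f \<noteq> 0"
  shows "initial_form f \<in> tangent_cone_ideal n"
  unfolding tangent_cone_ideal_def
  by (rule ring.genideal_self[THEN subsetD]) (use assms in \<open>auto intro: cring.axioms(1)[OF poly4_cring]\<close>)

lemma monomial_map_lin: "monomial_map n = lin_ext (\<lambda>e. Polynomial.monom 1 (weight n e))"
  by (rule ext) (simp add: monomial_map_def lin_ext_def smult_monom weight_def)

text \<open>
If some exponent of the initial form is longest, then an exponent of \<open>f\<close> with the same weight is at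
most as long by that, and at least as long because the initial form has least degree.  So all
exponents of \<open>f\<close> of this weight belong to the initial form, and their coefficients add up to a
coefficient of the image of \<open>f\<close> in \<open>K[t]\<close>, which is zero.
\<close>

lemma weight_map_initial_form:
  assumes f: "f \<in> curve_ideal n" "f \<noteq> 0"
  shows "weight_map n (initial_form f) = 0"
proof (rule poly_eqI)
  fix s
  let ?d = "Min (total_degree ` Poly_Mapping.keys f)"
  let ?A = "{e \<in> Poly_Mapping.keys f. total_degree e = ?d}"
  have look: "Poly_Mapping.lookup (initial_form f) e = (if e \<in> ?A then Poly_Mapping.lookup f e else 0)" for e
    by (auto simp: initial_form_def lookup_sum lookup_single when_def if_distrib sum.delta cong: if_cong)
  have keys: "Poly_Mapping.keys (initial_form f) = ?A"
    by (auto simp: in_keys_iff look split: if_splits)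
  have least: "?d \<le> total_degree e" if "e \<in> Poly_Mapping.keys f" for e
    using that by (intro Min_le) auto
  show "coeff (weight_map n (initial_form f)) s = coeff 0 s"
  proof (cases "\<exists>e\<in>?A. longest n e \<and> weight n e = s")
    case False
    then show ?thesis unfolding coeff_weight_map keys by (subst sum.neutral) auto
  next
    case True
    then obtain e0 where e0: "e0 \<in> ?A" "longest n e0" "weight n e0 = s" by blast
    have "total_degree e = ?d \<and> longest n e" if e: "e \<in> Poly_Mapping.keys f" "weight n e = s" for e
    proof -
      have "total_degree e \<le> total_degree e0" using e0 e(2) by (simp add: longest_def)
      then have "total_degree e = total_degree e0" using least[OF e(1)] e0(1) by simp
      then show ?thesis using e0 longest_cong[of n e e0] e(2) by simp
    qed
    then have "{e \<in> ?A. longest n e \<and> weight n e = s} = {e \<in> Poly_Mapping.keys f. True \<and> weight n e = s}"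
      by auto
    then have "coeff (weight_map n (initial_form f)) s =
        (\<Sum>e\<in>{e \<in> Poly_Mapping.keys f. True \<and> weight n e = s}. Poly_Mapping.lookup f e)"
      unfolding coeff_weight_map keys using look by (intro sum.cong) auto
    also have "\<dots> = coeff (monomial_map n f) s"
      unfolding monomial_map_lin using coeff_lin_monom[of "\<lambda>_. True" "weight n" f s] by simp
    also have "\<dots> = 0" using f(1) by (simp add: curve_ideal_def)
    finally show ?thesis by simp
  qed
qed

lemma binomial_in_curve_ideal:
  assumes "weight n d = weight n e"
  shows "Poly_Mapping.single d 1 - Poly_Mapping.single e 1 \<in> curve_ideal n"
  using assms by (simp add: curve_ideal_def monomial_map_lin lin_ext_diff)

lemma keys_binomial:
  assumes "d \<noteq> e"
  shows "Poly_Mapping.keys (Poly_Mapping.single d 1 - Poly_Mapping.single e (1 :: 'k :: field)) = {d, e}"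
  using assms by (auto simp: in_keys_iff lookup_minus lookup_single when_def split: if_splits)

text \<open>
\<open>X^e\<close> is the initial form of \<open>X^e - X^f\<close> for any longer \<open>f\<close> of the same weight.
\<close>

lemma non_longest_in_tangent_cone_ideal:
  assumes "\<not> longest n e"
  shows "Poly_Mapping.single e c \<in> (tangent_cone_ideal n :: 'k :: field poly4 set)"
proof -
  from assms obtain f where f: "weight n f = weight n e" "total_degree e < total_degree f"
    by (auto simp: longest_def not_le)
  then have ne: "e \<noteq> f" by auto
  let ?b = "Poly_Mapping.single e 1 - Poly_Mapping.single f (1 :: 'k)"
  have "{d \<in> {e, f}. total_degree d = Min (total_degree ` {e, f})} = {e}"
    using f(2) by auto
  then have "initial_form ?b = Poly_Mapping.single e 1"
    unfolding initial_form_def keys_binomial[OF ne] using ne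
    by (simp add: lookup_minus lookup_single)
  moreover have "?b \<noteq> 0" using keys_binomial[OF ne, where 'k = 'k] by force
  ultimately have "Poly_Mapping.single e (1 :: 'k) \<in> tangent_cone_ideal n"
    using initial_form_in_tangent_cone_ideal[of ?b n] binomial_in_curve_ideal[of n e f] f(1) by simp
  from ideal_poly4D(3)[OF tangent_cone_ideal_is_ideal this, of "Poly_Mapping.single 0 c"]
  show ?thesis by (simp add: mult_single)
qed

text \<open>
The two exponents have the same degree, so the binomial is its own initial form.
\<close>

lemma longest_binomial_in_tangent_cone_ideal:
  assumes "longest n e" "longest n f" "weight n e = weight n f"
  shows "Poly_Mapping.single e c - Poly_Mapping.single f c \<in> (tangent_cone_ideal n :: 'k :: field poly4 set)"
proof (cases "e = f")
  case True
  then show ?thesis using ideal_poly4D(1)[OF tangent_cone_ideal_is_ideal] by simp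
next
  case ne: False
  let ?b = "Poly_Mapping.single e 1 - Poly_Mapping.single f (1 :: 'k)"
  have deg: "total_degree e = total_degree f" using longest_same assms by blast
  have "{d \<in> {e, f}. total_degree d = Min (total_degree ` {e, f})} = {e, f}"
    using deg by auto
  then have "initial_form ?b = ?b"
    unfolding initial_form_def keys_binomial[OF ne] using ne
    by (simp add: lookup_minus lookup_single single_uminus)
  moreover have "?b \<noteq> 0" using keys_binomial[OF ne, where 'k = 'k] by force
  ultimately have "?b \<in> tangent_cone_ideal n"
    using initial_form_in_tangent_cone_ideal[of ?b n] binomial_in_curve_ideal[of n e f] assms(3) by simp
  from ideal_poly4D(3)[OF tangent_cone_ideal_is_ideal this, of "Poly_Mapping.single 0 c"]
  show ?thesis by (simp add: mult_single right_diff_distrib)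
qed

text \<open>
To see that the kernel of \<open>weight_map\<close> is small enough, choose one longest exponent vector for every
weight.  Modulo the tangent cone ideal each polynomial is a combination of the chosen monomials, with
the coefficients of its \<open>weight_map\<close>.
\<close>

lemma tangent_cone_ideal_eq:
  "tangent_cone_ideal n = {f :: 'k :: field poly4. weight_map n f = 0}"
proof
  have "ideal {f :: 'k poly4. weight_map n f = 0} poly4_ring"
    by (rule ideal_poly4I) (simp_all add: weight_map_add weight_map_mult_zero)
  then show "tangent_cone_ideal n \<subseteq> {f :: 'k poly4. weight_map n f = 0}"
    unfolding tangent_cone_ideal_def
    by (rule ring.genideal_minimal[OF cring.axioms(1)[OF poly4_cring]]) (auto simp: weight_map_initial_form)
next
  note T = ideal_poly4D[OF tangent_cone_ideal_is_ideal[of n]]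
  define rep where "rep s = (SOME e. longest n e \<and> weight n e = s)" for s
  have rep: "longest n (rep (weight n e))" "weight n (rep (weight n e)) = weight n e" if "longest n e" for e
    using someI[of "\<lambda>d. longest n d \<and> weight n d = weight n e" e] that by (auto simp: rep_def)
  define lift :: "'k poly \<Rightarrow> 'k poly4" where
    "lift q = (\<Sum>s\<le>degree q. Poly_Mapping.single (rep s) (coeff q s))" for q
  have lift_eq: "lift q = (\<Sum>s\<le>N. Poly_Mapping.single (rep s) (coeff q s))" if "degree q \<le> N" for q N
    unfolding lift_def using that
    by (intro sum.mono_neutral_left) (auto simp: coeff_eq_0)
  have lift_add: "lift (p + q) = lift p + lift q" for p q
    using degree_add_le_max[of p q]
    by (simp add: lift_eq[of _ "max (degree p) (degree q)"] single_add sum.distrib)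
  have lift_monom: "lift (Polynomial.monom c s) = Poly_Mapping.single (rep s) c" for c s
  proof -
    have "lift (Polynomial.monom c s) = (\<Sum>t\<le>s. Poly_Mapping.single (rep t) (coeff (Polynomial.monom c s) t))"
      by (rule lift_eq[OF degree_monom_le])
    also have "\<dots> = (\<Sum>t\<le>s. if s = t then Poly_Mapping.single (rep t) c else 0)"
      by (intro sum.cong) auto
    finally show ?thesis by simp
  qed
  have diff: "f - lift (weight_map n f) \<in> tangent_cone_ideal n" for f :: "'k poly4"
  proof (induction f rule: poly_mapping_induct_single)
    case zero
    then show ?case using T(1) by (simp add: lift_def)
  next
    case (single e c)
    show ?case
    proof (cases "longest n e")
      case True
      then show ?thesis
        using longest_binomial_in_tangent_cone_ideal[OF True rep(1)[OF True] rep(2)[OF True, symmetric]]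
        by (simp add: weight_map_single lift_monom)
    next
      case False
      then show ?thesis
        using non_longest_in_tangent_cone_ideal[OF False, of c] by (simp add: weight_map_single lift_def)
    qed
  next
    case (add f g)
    then show ?case
      using T(2)[of "f - lift (weight_map n f)" "g - lift (weight_map n g)"]
      by (simp add: weight_map_add lift_add algebra_simps)
  qed
  show "{f :: 'k poly4. weight_map n f = 0} \<subseteq> tangent_cone_ideal n"
  proof
    fix f :: "'k poly4" assume "f \<in> {f :: 'k poly4. weight_map n f = 0}"
    then show "f \<in> tangent_cone_ideal n" using diff[of f] by (simp add: lift_def)
  qed
qed

section \<open>The tangent cone as a finite extension of the second axis\<close>

locale poly_module = Modules.module scale
  for scale :: "'k :: field poly \<Rightarrow> 'b :: ab_group_add \<Rightarrow> 'b"
begin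

text \<open>
Submodules of finitely generated \<open>K[X]\<close>-modules are finitely generated.  When a generator \<open>m\<close> is added
to \<open>S\<close>, the coefficients of \<open>m\<close> in elements of \<open>U\<close> form an ideal; an element \<open>w\<close> of \<open>U\<close> whose coefficient
\<open>g\<close> has least degree, together with generators of \<open>U \<inter> span S\<close>, generates \<open>U\<close>.
\<close>

lemma subspace_of_finite_span:
  assumes "finite S" "subspace U" "U \<subseteq> span S"
  obtains B where "finite B" "B \<subseteq> U" "span B = U"
proof -
  have "\<exists>B. finite B \<and> B \<subseteq> U \<and> span B = U"
    using assms
  proof (induction S arbitrary: U)
    case empty
    then have "U = {0}" using subspace_0[of U] by auto
    then show ?case by (intro exI[of _ "{}"]) simp
  next
    case (insert m S)
    define V where "V = U \<inter> span S"
    have "subspace V" unfolding V_def using insert.prems(1) subspace_span by (rule subspace_inter)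
    then obtain B where B: "finite B" "B \<subseteq> V" "span B = V"
      using insert.IH[of V] by (auto simp: V_def)
    define P where "P p \<longleftrightarrow> (\<exists>u\<in>U. u - scale p m \<in> span S)" for p
    have ex: "\<exists>p. P p \<and> u - scale p m \<in> span S" if "u \<in> U" for u
      using that insert.prems(2) span_breakdown_eq[of u m S] by (auto simp: P_def)
    show ?case
    proof (cases "\<exists>p. P p \<and> p \<noteq> 0")
      case False
      have "u \<in> span S" if "u \<in> U" for u
        using ex[OF that] False by force
      then have "V = U" by (auto simp: V_def)
      with B show ?thesis by blast
    next
      case True
      then have "\<exists>g. (P g \<and> g \<noteq> 0) \<and> (\<forall>p. P p \<and> p \<noteq> 0 \<longrightarrow> degree g \<le> degree p)"
        using ex_has_least_nat[of "\<lambda>p. P p \<and> p \<noteq> 0" _ degree] by blast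
      then obtain g where g: "P g" "g \<noteq> 0" and least: "\<And>p. \<lbrakk>P p; p \<noteq> 0\<rbrakk> \<Longrightarrow> degree g \<le> degree p"
        by blast
      obtain w where w: "w \<in> U" "w - scale g m \<in> span S" using g(1) by (auto simp: P_def)
      have "U \<subseteq> span (insert w B)"
      proof
        fix u assume u: "u \<in> U"
        obtain p where p: "u - scale p m \<in> span S" using ex[OF u] by blast
        define v where "v = u - scale (p div g) w"
        have vU: "v \<in> U"
          unfolding v_def using insert.prems(1) u w(1) by (intro subspace_diff subspace_scale)
        have "p mod g = p - (p div g) * g" by (simp add: minus_div_mult_eq_mod)
        then have "v - scale (p mod g) m = (u - scale p m) - scale (p div g) (w - scale g m)"
          by (simp add: v_def scale_left_diff_distrib scale_right_diff_distrib)
        then have vS: "v - scale (p mod g) m \<in> span S"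
          using p w(2) by (simp add: span_diff span_scale)
        then have "P (p mod g)" using vU by (auto simp: P_def)
        then have "p mod g = 0"
          using least[of "p mod g"] degree_mod_less[OF g(2), of p] by force
        then have "v \<in> span B" using vS vU B(3) by (simp add: V_def)
        moreover have "u = v + scale (p div g) w" by (simp add: v_def)
        ultimately show "u \<in> span (insert w B)"
          using span_mono[of B "insert w B"] by (metis span_add span_base span_scale insertI1 subset_insertI subsetD)
      qed
      moreover have "span (insert w B) \<subseteq> U"
        using B(2) w(1) insert.prems(1) by (intro span_minimal) (auto simp: V_def)
      ultimately show ?thesis
        using B w(1) by (intro exI[of _ "insert w B"]) (auto simp: V_def)
    qed
  qed
  then show ?thesis using that by blast
qed

end


definition axis2 :: "nat \<Rightarrow> nat ^ 4" where
  "axis2 k = (\<chi> i. if i = 2 then k else 0)"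

text \<open>
Restriction of a polynomial to the second coordinate axis, that is, \<open>X1 = X3 = X4 = 0\<close>.
\<close>

definition axis2_map :: "'k :: field poly4 \<Rightarrow> 'k poly" where
  "axis2_map = lin_ext (\<lambda>e. if e = axis2 (e $ 2) then Polynomial.monom 1 (e $ 2) else 0)"

definition X2 :: "'k :: field poly4" where
  "X2 = Poly_Mapping.single (axis2 1) 1"

text \<open>
Substitution of the second variable for the variable of a univariate polynomial, through which \<open>K[X]\<close>
acts on the polynomial ring in four variables.
\<close>

definition in_X2 :: "'k :: field poly \<Rightarrow> 'k poly4" where
  "in_X2 p = poly (map_poly (Poly_Mapping.single 0) p) X2"

lemma in_X2_zero [simp]: "in_X2 0 = 0"
  by (simp add: in_X2_def)

lemma in_X2_pCons: "in_X2 (pCons a p) = Poly_Mapping.single 0 a + X2 * in_X2 p"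
  by (simp add: in_X2_def map_poly_pCons)

lemma in_X2_add: "in_X2 (p + q) = in_X2 p + in_X2 q"
proof (induction p arbitrary: q)
  case (pCons a p)
  then show ?case
    by (cases q) (simp add: in_X2_pCons single_add algebra_simps)
qed simp

lemma in_X2_smult: "in_X2 (smult a p) = Poly_Mapping.single 0 a * in_X2 p"
  by (induction p) (simp_all add: in_X2_pCons distrib_left mult_single ac_simps)

lemma in_X2_mult: "in_X2 (p * q) = in_X2 p * in_X2 q"
  by (induction p) (simp_all add: in_X2_add in_X2_smult in_X2_pCons distrib_right mult.assoc)

lemma in_X2_one [simp]: "in_X2 1 = 1"
  by (simp add: one_pCons in_X2_pCons)

lemma axis2_nth [simp]: "axis2 k $ i = (if i = 2 then k else 0)"
  by (simp add: axis2_def)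

lemma axis2_add: "axis2 (j + k) = axis2 j + axis2 k"
  by (simp add: vec_eq_iff)

lemma axis2_zero [simp]: "axis2 0 = 0"
  by (simp add: vec_eq_iff)

lemma in_X2_monom: "in_X2 (Polynomial.monom c k) = Poly_Mapping.single (axis2 k) c"
proof (induction k)
  case 0
  then show ?case by (simp add: monom_0 in_X2_pCons)
next
  case (Suc k)
  then show ?case
    by (simp add: monom_Suc in_X2_pCons X2_def mult_single axis2_add[symmetric])
qed

lemma poly4_module: "poly_module (\<lambda>p f. in_X2 p * f)"
  by unfold_locales (simp_all add: in_X2_add in_X2_mult distrib_left distrib_right mult.assoc)

lemma eq_axis2_iff: "e = axis2 k \<longleftrightarrow> e $ 1 = 0 \<and> e $ 2 = k \<and> e $ 3 = 0 \<and> e $ 4 = 0"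
  by (simp add: vec_eq_iff forall_4)

lemma axis2_map_mult: "axis2_map (f * g) = axis2_map f * axis2_map g"
  unfolding axis2_map_def
  by (rule lin_ext_mult) (simp add: eq_axis2_iff mult_monom)

lemma axis2_map_add: "axis2_map (f + g) = axis2_map f + axis2_map g"
  by (simp add: axis2_map_def lin_ext_add)

lemma axis2_map_single:
  "axis2_map (Poly_Mapping.single e c) = (if e = axis2 (e $ 2) then Polynomial.monom c (e $ 2) else 0)"
  by (simp add: axis2_map_def smult_monom)

lemma axis2_map_zero [simp]: "axis2_map 0 = 0"
  by (simp add: axis2_map_def)

lemma axis2_map_one [simp]: "axis2_map 1 = 1"
  using axis2_map_single[of 0 1] by (simp add: monom_0 one_pCons)

lemma axis2_map_X2: "axis2_map X2 = [:0, 1:]"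
  by (simp add: X2_def axis2_map_single monom_Suc monom_0)

lemma axis2_map_in_X2 [simp]: "axis2_map (in_X2 p) = p"
  by (induction p) (simp_all add: in_X2_pCons axis2_map_add axis2_map_mult axis2_map_X2
      axis2_map_single monom_0)


locale smallest_second =
  fixes n :: "nat ^ 4"
  assumes pos: "0 < n $ i" and smallest: "i \<noteq> 2 \<Longrightarrow> n $ 2 < n $ i"
begin

lemma weight_axis2: "weight n (axis2 k) = k * n $ 2"
  by (simp add: weight_def if_distrib[of "\<lambda>x. x * _"] cong: if_cong)

lemma total_degree_axis2: "total_degree (axis2 k) = k"
  by (simp add: total_degree_def)

lemma smallest_le: "n $ 2 \<le> n $ i"
  using smallest[of i] by (cases "i = 2") auto

lemma total_degree_le_weight: "total_degree e * n $ 2 \<le> weight n e"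
  unfolding total_degree_def weight_def sum_distrib_right
  by (intro sum_mono mult_le_mono2 smallest_le)

lemma total_degree_less_weight:
  assumes "e \<noteq> axis2 (e $ 2)"
  shows "total_degree e * n $ 2 < weight n e"
proof -
  obtain i where i: "i \<noteq> 2" "0 < e $ i" using assms by (auto simp: vec_eq_iff split: if_splits)
  show ?thesis
    unfolding total_degree_def weight_def sum_distrib_right
    using smallest[OF i(1)] i(2)
    by (intro sum_strict_mono_ex1 ballI mult_le_mono2 smallest_le bexI[of _ i]) simp_all
qed

lemma longest_axis2: "longest n (axis2 k)"
  unfolding longest_def weight_axis2 total_degree_axis2
  using total_degree_le_weight pos[of 2] by (metis mult_le_cancel2)

text \<open>
A factorization of \<open>s\<close> has length at most \<open>s / n 2\<close>, and only powers of the second variable attain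
this bound.
\<close>

lemma longest_weight_axis2:
  assumes "longest n e" "weight n e = k * n $ 2"
  shows "e = axis2 k"
proof -
  have "k \<le> total_degree e"
    using assms weight_axis2[of k] total_degree_axis2[of k] unfolding longest_def by metis
  moreover have "total_degree e \<le> k"
    using total_degree_le_weight[of e] assms(2) pos[of 2] by simp
  ultimately have "total_degree e = k" by simp
  then have e: "e = axis2 (e $ 2)"
    using total_degree_less_weight[of e] assms(2) by force
  then have "total_degree e = e $ 2" by (metis total_degree_axis2)
  with e \<open>total_degree e = k\<close> show ?thesis by simp
qed

text \<open>
The coefficient of \<open>X2 ^ k\<close> in \<open>f\<close> reappears as the coefficient of \<open>weight_map n f\<close> at \<open>k * n 2\<close>, because
no other longest exponent vector has that weight.
\<close>

lemma axis2_map_eq_0_if_weight_map_eq_0: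
  assumes "weight_map n f = 0"
  shows "axis2_map f = 0"
proof (rule poly_eqI)
  fix k
  have "e = axis2 (e $ 2) \<and> e $ 2 = k \<longleftrightarrow> longest n e \<and> weight n e = k * n $ 2" for e
  proof
    assume "e = axis2 (e $ 2) \<and> e $ 2 = k"
    then show "longest n e \<and> weight n e = k * n $ 2" using longest_axis2 weight_axis2 by metis
  next
    assume "longest n e \<and> weight n e = k * n $ 2"
    then have "e = axis2 k" using longest_weight_axis2 by blast
    then show "e = axis2 (e $ 2) \<and> e $ 2 = k" by simp
  qed
  then have "coeff (axis2_map f) k = coeff (weight_map n f) (k * n $ 2)"
    by (simp add: axis2_map_def coeff_lin_monom coeff_weight_map)
  then show "coeff (axis2_map f) k = coeff 0 k" using assms by simp
qed

text \<open>
The factor \<open>X i ^ n 2\<close> of \<open>X^e\<close> has the same weight as \<open>X 2 ^ n i\<close>, which is longer.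
\<close>

lemma not_longest:
  fixes e :: "nat ^ 4"
  assumes "i \<noteq> 2" "n $ 2 \<le> e $ i"
  shows "\<not> longest n e"
proof
  assume l: "longest n e"
  define d where "d = (\<chi> j. if j = i then e $ j - n $ 2 else e $ j)"
  define x :: "nat ^ 4" where "x = (\<chi> j. if j = i then n $ 2 else 0)"
  have "e = d + x" using assms(2) by (simp add: vec_eq_iff d_def x_def)
  then have "longest n x" using l longest_cancel by metis
  moreover have "weight n x = n $ i * n $ 2"
    by (simp add: weight_def x_def if_distrib[of "\<lambda>x. x * _"] cong: if_cong)
  ultimately have "x = axis2 (n $ i)" by (rule longest_weight_axis2)
  then have "x $ i = axis2 (n $ i) $ i" by simp
  then show False using assms(1) pos[of 2] by (simp add: x_def)
qed

text \<open>
Every monomial of \<open>f\<close> involves one of the three other variables, so every monomial of \<open>f ^ (3 * n 2)\<close>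
involves one of them to a power of at least \<open>n 2\<close>.
\<close>

lemma weight_map_power_eq_0:
  assumes "axis2_map f = (0 :: 'k :: field poly)"
  shows "weight_map n (f ^ (3 * n $ 2)) = 0"
proof -
  have key: "1 \<le> e $ 1 + e $ 3 + e $ 4" if "e \<in> Poly_Mapping.keys f" for e
  proof (rule ccontr)
    assume "\<not> 1 \<le> e $ 1 + e $ 3 + e $ 4"
    then have e: "e = axis2 (e $ 2)" by (simp add: eq_axis2_iff)
    have "coeff (axis2_map f) (e $ 2) =
        (\<Sum>d\<in>{d \<in> Poly_Mapping.keys f. d = axis2 (d $ 2) \<and> d $ 2 = e $ 2}. Poly_Mapping.lookup f d)"
      by (simp add: axis2_map_def coeff_lin_monom)
    also have "d = axis2 (d $ 2) \<and> d $ 2 = e $ 2 \<longleftrightarrow> d = e" for d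
      using e by metis
    then have "{d \<in> Poly_Mapping.keys f. d = axis2 (d $ 2) \<and> d $ 2 = e $ 2} = {e}"
      using that by blast
    finally show False using assms that by (simp add: in_keys_iff)
  qed
  have keys: "m \<le> e $ 1 + e $ 3 + e $ 4" if "e \<in> Poly_Mapping.keys (f ^ m)" for e m
    using that
  proof (induction m arbitrary: e)
    case (Suc m)
    then obtain a b where "e = a + b" "a \<in> Poly_Mapping.keys f" "b \<in> Poly_Mapping.keys (f ^ m)"
      using keys_mult[of f "f ^ m"] by auto
    then show ?case using key[of a] Suc.IH[of b] by simp
  qed simp
  have "\<not> longest n e" if "e \<in> Poly_Mapping.keys (f ^ (3 * n $ 2))" for e
  proof -
    have "n $ 2 \<le> e $ 1 \<or> n $ 2 \<le> e $ 3 \<or> n $ 2 \<le> e $ 4"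
      using keys[OF that] by linarith
    then show ?thesis using not_longest[of 1 e] not_longest[of 3 e] not_longest[of 4 e] by auto
  qed
  then show ?thesis
    unfolding weight_map_def lin_ext_def by (intro sum.neutral) auto
qed

definition monomial_generators :: "'k :: field poly4 set" where
  "monomial_generators = (\<lambda>e. Poly_Mapping.single e 1) ` {e. e $ 2 = 0 \<and> (\<forall>i. e $ i < n $ 2)}"

lemma finite_monomial_generators: "finite (monomial_generators :: 'k :: field poly4 set)"
proof -
  let ?F = "PiE UNIV (\<lambda>_ :: 4. {..<n $ 2})"
  have "{e :: nat ^ 4. \<forall>i. e $ i < n $ 2} \<subseteq> vec_lambda ` ?F"
  proof
    fix e :: "nat ^ 4" assume "e \<in> {e. \<forall>i. e $ i < n $ 2}"
    then have "vec_nth e \<in> ?F" by auto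
    then show "e \<in> vec_lambda ` ?F" by (metis image_eqI vec_nth_inverse)
  qed
  moreover have "finite ?F" by (intro finite_PiE) auto
  ultimately have "finite {e :: nat ^ 4. \<forall>i. e $ i < n $ 2}"
    using finite_surj by blast
  then show ?thesis
    unfolding monomial_generators_def
    by (intro finite_imageI) (rule rev_finite_subset, auto)
qed

text \<open>
Over \<open>K[X 2]\<close> the tangent cone ring is generated by the finitely many monomials in the other variables
with exponents below \<open>n 2\<close>.
\<close>

lemma weight_map_eq_on_span:
  fixes f :: "'k :: field poly4"
  obtains g where "g \<in> Modules.module.span (\<lambda>p f. in_X2 p * f) monomial_generators" "weight_map n (f - g) = 0"
proof -
  interpret poly_module "\<lambda>p f. in_X2 p * f :: 'k poly4" by (rule poly4_module)
  have "\<exists>g\<in>span monomial_generators. weight_map n (f - g) = 0"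
  proof (induction f rule: poly_mapping_induct_single)
    case zero
    show ?case by (intro bexI[of _ 0]) (auto simp: span_zero)
  next
    case (single e c)
    show ?case
    proof (cases "\<exists>i. i \<noteq> 2 \<and> n $ 2 \<le> e $ i")
      case True
      then have "\<not> longest n e" using not_longest by blast
      then show ?thesis by (intro bexI[of _ 0]) (auto simp: span_zero weight_map_single)
    next
      case False
      define d where "d = (\<chi> i. if i = 2 then 0 else e $ i)"
      have "d $ i < n $ 2" for i using False pos[of 2] by (cases "i = 2") (auto simp: d_def)
      then have "Poly_Mapping.single d (1 :: 'k) \<in> monomial_generators"
        by (auto simp: monomial_generators_def d_def)
      then have "in_X2 (Polynomial.monom c (e $ 2)) * Poly_Mapping.single d 1 \<in> span monomial_generators"
        by (intro span_scale span_base)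
      moreover have "axis2 (e $ 2) + d = e" by (simp add: vec_eq_iff d_def)
      ultimately have "Poly_Mapping.single e c \<in> span monomial_generators"
        by (simp add: in_X2_monom mult_single)
      then show ?thesis by force
    qed
  next
    case (add f g)
    then obtain f' g' where "f' \<in> span monomial_generators" "weight_map n (f - f') = 0"
      "g' \<in> span monomial_generators" "weight_map n (g - g') = 0" by blast
    then show ?case
      by (intro bexI[of _ "f' + g'"]) (auto simp: span_add weight_map_diff weight_map_add)
  qed
  then show ?thesis using that by blast
qed

end

definition coset :: "nat ^ 4 \<Rightarrow> 'k :: field poly4 \<Rightarrow> 'k poly4 set" where
  "coset n f = tangent_cone_ideal n +>\<^bsub>poly4_ring\<^esub> f"

text \<open>
These facts allow computing with representatives only.
\<close>

lemma coset_ring: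
  "carrier (tangent_cone_ring n) = range (coset n :: 'k :: field poly4 \<Rightarrow> _)"
  "coset n f \<otimes>\<^bsub>tangent_cone_ring n\<^esub> coset n g = coset n (f * (g :: 'k poly4))"
  "coset n f \<oplus>\<^bsub>tangent_cone_ring n\<^esub> coset n g = coset n (f + (g :: 'k poly4))"
  "\<one>\<^bsub>tangent_cone_ring n\<^esub> = coset n (1 :: 'k poly4)"
  "\<zero>\<^bsub>tangent_cone_ring n\<^esub> = coset n (0 :: 'k poly4)"
  "coset n f = coset n (g :: 'k poly4) \<longleftrightarrow> weight_map n (f - g) = 0"
  "cring (tangent_cone_ring n :: 'k poly4 set ring)"
proof -
  interpret cring "poly4_ring :: 'k poly4 ring" by (rule poly4_cring)
  interpret T: ideal "tangent_cone_ideal n :: 'k poly4 set" poly4_ring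
    by (rule tangent_cone_ideal_is_ideal)
  note hom = T.rcos_ring_hom
  show "carrier (tangent_cone_ring n) = range (coset n :: 'k poly4 \<Rightarrow> _)"
    by (auto simp: tangent_cone_ring_def FactRing_def A_RCOSETS_def' coset_def)
  show "coset n f \<otimes>\<^bsub>tangent_cone_ring n\<^esub> coset n g = coset n (f * (g :: 'k poly4))"
    using ring_hom_mult[OF hom, of f g] by (simp add: tangent_cone_ring_def coset_def)
  show "coset n f \<oplus>\<^bsub>tangent_cone_ring n\<^esub> coset n g = coset n (f + (g :: 'k poly4))"
    using ring_hom_add[OF hom, of f g] by (simp add: tangent_cone_ring_def coset_def)
  show "\<one>\<^bsub>tangent_cone_ring n\<^esub> = coset n (1 :: 'k poly4)"
    using ring_hom_one[OF hom] by (simp add: tangent_cone_ring_def coset_def)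
  show "\<zero>\<^bsub>tangent_cone_ring n\<^esub> = coset n (0 :: 'k poly4)"
    using a_rcos_zero[OF T.ideal_axioms T.zero_closed]
    by (simp add: tangent_cone_ring_def coset_def FactRing_def)
  show "coset n f = coset n (g :: 'k poly4) \<longleftrightarrow> weight_map n (f - g) = 0"
    using quotient_eq_iff_same_a_r_cos[OF T.ideal_axioms, of f g]
    by (simp add: coset_def a_minus_def poly4_ring_minus tangent_cone_ideal_eq)
  show "cring (tangent_cone_ring n :: 'k poly4 set ring)"
    unfolding tangent_cone_ring_def by (rule T.quotient_is_cring[OF poly4_cring])
qed

text \<open>
The map induced by \<open>axis2_map\<close> on the tangent cone ring; the choice of a representative is immaterial
since the tangent cone ideal lies in the kernel.
\<close>

definition axis2_map_on_cosets :: "nat ^ 4 \<Rightarrow> 'k :: field poly4 set \<Rightarrow> 'k poly" where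
  "axis2_map_on_cosets n C = axis2_map (SOME f. coset n f = C)"

context smallest_second
begin

lemma axis2_map_on_cosets_coset: "axis2_map_on_cosets n (coset n f) = axis2_map f"
proof -
  have "coset n (SOME g. coset n g = coset n f) = coset n f" by (rule someI[of _ f]) simp
  then have "axis2_map ((SOME g. coset n g = coset n f) - f) = 0"
    using axis2_map_eq_0_if_weight_map_eq_0 by (simp add: coset_ring(6))
  then show ?thesis by (simp add: axis2_map_on_cosets_def axis2_map_def lin_ext_diff)
qed

lemma coset_power: "coset n f [^]\<^bsub>tangent_cone_ring n\<^esub> (m :: nat) = coset n (f ^ m)"
  by (induction m) (simp_all add: coset_ring(2,4) mult.commute)

lemma tangent_cone_thickening:
  "nilpotent_thickening (tangent_cone_ring n :: 'k :: field poly4 set ring) (axis2_map_on_cosets n)"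
proof (intro nilpotent_thickening.intro nilpotent_thickening_axioms.intro coset_ring(7))
  fix C :: "'k poly4 set"
  assume "C \<in> carrier (tangent_cone_ring n)" "axis2_map_on_cosets n C = 0"
  then obtain f where f: "C = coset n f" "axis2_map f = 0"
    by (auto simp: coset_ring(1) axis2_map_on_cosets_coset)
  then have "C [^]\<^bsub>tangent_cone_ring n\<^esub> (3 * n $ 2) = \<zero>\<^bsub>tangent_cone_ring n\<^esub>"
    using weight_map_power_eq_0 by (simp add: coset_power coset_ring(5,6))
  then show "\<exists>m :: nat. C [^]\<^bsub>tangent_cone_ring n\<^esub> m = \<zero>\<^bsub>tangent_cone_ring n\<^esub>" by blast
next
  fix p :: "'k poly"
  show "\<exists>C\<in>carrier (tangent_cone_ring n). axis2_map_on_cosets n C = p"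
    by (intro bexI[of _ "coset n (in_X2 p)"]) (simp_all add: coset_ring(1) axis2_map_on_cosets_coset)
qed (auto simp: coset_ring(1-4) axis2_map_on_cosets_coset axis2_map_mult axis2_map_add)

text \<open>
An ideal is a submodule over \<open>K[X 2]\<close>, over which the ring is finite.
\<close>

lemma tangent_cone_noetherian: "noetherian_ring (tangent_cone_ring n :: 'k :: field poly4 set ring)"
proof -
  let ?R = "tangent_cone_ring n :: 'k poly4 set ring"
  interpret R: cring ?R by (rule coset_ring(7))
  interpret poly_module "\<lambda>p f. in_X2 p * f :: 'k poly4" by (rule poly4_module)
  have sub: "subspace {f. coset n f \<in> I}" if "ideal I ?R" for I
  proof -
    interpret I: ideal I ?R by fact
    show ?thesis
    proof (rule subspaceI)
      show "0 \<in> {f. coset n f \<in> I}" using I.zero_closed by (simp add: coset_ring(5))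
    next
      fix f g assume "f \<in> {f. coset n f \<in> I}" "g \<in> {f. coset n f \<in> I}"
      then show "f + g \<in> {f. coset n f \<in> I}"
        using I.a_closed[of "coset n f" "coset n g"] by (simp add: coset_ring(3))
    next
      fix p f assume "f \<in> {f. coset n f \<in> I}"
      then show "in_X2 p * f \<in> {f. coset n f \<in> I}"
        using I.I_l_closed[of "coset n f" "coset n (in_X2 p)"] by (simp add: coset_ring(1,2))
    qed
  qed
  show ?thesis
  proof (rule R.noetherian_ringI)
    fix I assume I: "ideal I ?R"
    let ?V = "{f. coset n f \<in> I} \<inter> span monomial_generators"
    have "subspace ?V" by (intro subspace_inter sub I subspace_span)
    then obtain B where B: "finite B" "B \<subseteq> ?V" "span B = ?V"
      using subspace_of_finite_span[OF finite_monomial_generators, of ?V] by blast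
    have carr: "coset n ` B \<subseteq> carrier ?R" by (auto simp: coset_ring(1))
    have Idl: "ideal (Idl\<^bsub>?R\<^esub> (coset n ` B)) ?R" using carr by (rule R.genideal_ideal)
    have "I \<subseteq> Idl\<^bsub>?R\<^esub> (coset n ` B)"
    proof
      fix C assume C: "C \<in> I"
      then have "C \<in> carrier ?R" using ideal.Icarr[OF I] by blast
      then obtain f where f: "C = coset n f" by (auto simp: coset_ring(1))
      obtain g where g: "g \<in> span monomial_generators" "weight_map n (f - g) = 0"
        by (rule weight_map_eq_on_span)
      then have Cg: "C = coset n g" using f by (simp add: coset_ring(6))
      have "g \<in> span B" using g(1) C Cg unfolding B(3) by simp
      moreover have "B \<subseteq> {f. coset n f \<in> Idl\<^bsub>?R\<^esub> (coset n ` B)}"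
        using R.genideal_self[OF carr] by blast
      then have "span B \<subseteq> {f. coset n f \<in> Idl\<^bsub>?R\<^esub> (coset n ` B)}"
        using sub[OF Idl] by (rule span_minimal)
      ultimately show "C \<in> Idl\<^bsub>?R\<^esub> (coset n ` B)" unfolding Cg by blast
    qed
    moreover have "Idl\<^bsub>?R\<^esub> (coset n ` B) \<subseteq> I"
      using B(2) by (intro R.genideal_minimal[OF I]) blast
    ultimately show "\<exists>A\<subseteq>carrier ?R. finite A \<and> I = Idl\<^bsub>?R\<^esub> A"
      using carr B(1) by (intro exI[of _ "coset n ` B"]) blast
  qed
qed

lemma weight_map_X2_mult:
  assumes "\<And>e. longest n e \<Longrightarrow> longest n (e + axis2 1)"
  shows "weight_map n (X2 * f) = Polynomial.monom 1 (n $ 2) * weight_map n f"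
proof -
  have "longest n (axis2 1 + e) \<longleftrightarrow> longest n e" for e
    using assms[of e] longest_cancel[of n "axis2 1" e] by (auto simp: add.commute)
  then show ?thesis
    by (induction f rule: poly_mapping_induct_single)
      (simp_all add: X2_def mult_single weight_map_single weight_add weight_axis2 mult_monom
        distrib_left weight_map_add)
qed

text \<open>
Under the stability assumption \<open>weight_map\<close> turns the tangent cone ring into a submodule of the domain
\<open>K[t]\<close>, on which \<open>X 2\<close> acts as \<open>t ^ n 2\<close>; so it is torsion free over \<open>K[X 2]\<close>.
\<close>

lemma weight_map_in_X2_mult:
  assumes "\<And>e. longest n e \<Longrightarrow> longest n (e + axis2 1)"
  shows "weight_map n (in_X2 p * f) = pcompose p (Polynomial.monom 1 (n $ 2)) * weight_map n f"
proof (induction p)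
  case (pCons a p)
  have "weight_map n (Poly_Mapping.single 0 a * f) = [:a:] * weight_map n f"
    by (simp add: weight_map_def lin_ext_single_mult cong: if_cong)
  then show ?case
    using pCons
    by (simp add: weight_map_X2_mult[OF assms] in_X2_pCons pcompose_pCons distrib_right weight_map_add mult.assoc del: mult_pCons_left)
qed simp

text \<open>
A longest \<open>e\<close> for which \<open>e + axis2 1\<close> is not longest gives a nonzero class annihilated by \<open>X 2\<close>.  If
there is none, then every nonzero polynomial in \<open>X 2\<close> is regular, because the ring is torsion free.
\<close>

lemma cohen_macaulay_iff_longest_stable:
  "cohen_macaulay (tangent_cone_ring n :: 'k :: field poly4 set ring) \<longleftrightarrow>
     (\<forall>e. longest n e \<longrightarrow> longest n (e + axis2 1))"
proof -
  let ?R = "tangent_cone_ring n :: 'k poly4 set ring"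
  interpret nilpotent_thickening ?R "axis2_map_on_cosets n" by (rule tangent_cone_thickening)
  have regular: "regular_element (coset n f) \<longleftrightarrow> (\<forall>g. weight_map n (f * g) = 0 \<longrightarrow> weight_map n g = 0)"
    for f :: "'k poly4"
    by (auto simp: regular_element_def coset_ring)
  show ?thesis
  proof
    assume cm: "cohen_macaulay ?R"
    have reg: "regular_element (coset n (X2 :: 'k poly4))"
      using cm by (rule cohen_macaulay_imp_regular) (simp_all add: coset_ring(1) axis2_map_on_cosets_coset axis2_map_X2)
    show "\<forall>e. longest n e \<longrightarrow> longest n (e + axis2 1)"
    proof (intro allI impI, rule ccontr)
      fix e assume e: "longest n e" "\<not> longest n (e + axis2 1)"
      then have "weight_map n ((X2 :: 'k poly4) * Poly_Mapping.single e 1) = 0"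
        by (simp add: X2_def mult_single weight_map_single add.commute)
      then have "weight_map n (Poly_Mapping.single e (1 :: 'k)) = 0"
        using reg regular by blast
      with e(1) show False by (simp add: weight_map_single)
    qed
  next
    assume "\<forall>e. longest n e \<longrightarrow> longest n (e + axis2 1)"
    then have stable: "longest n (e + axis2 1)" if "longest n e" for e using that by blast
    show "cohen_macaulay ?R"
    proof (rule cohen_macaulayI[OF tangent_cone_noetherian])
      fix p :: "'k poly" assume "p \<noteq> 0"
      moreover have "0 < degree (Polynomial.monom (1 :: 'k) (n $ 2))"
        using pos[of 2] by (simp add: degree_monom_eq)
      ultimately have "pcompose p (Polynomial.monom 1 (n $ 2)) \<noteq> 0"
        by (simp add: pcompose_eq_0_iff)
      then have "regular_element (coset n (in_X2 p))"
        by (simp add: regular weight_map_in_X2_mult[OF stable])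
      then show "\<exists>C. regular_element C \<and> axis2_map_on_cosets n C = p"
        by (intro exI[of _ "coset n (in_X2 p)"]) (simp add: axis2_map_on_cosets_coset)
    qed
  qed
qed

end

section \<open>Factorizations in the semigroup\<close>

text \<open>
The relations express that the two sides of Komeda's five binomials have the same weight, with \<open>b\<close> in
the role of \<open>\<alpha>21\<close>.  By \<open>n2_eq\<close> the number \<open>n2\<close> counts the normal monomials introduced below, and
\<open>residues\<close> is how the coprimality of the generators enters.
\<close>

locale komeda_weights =
  fixes n1 n2 n3 n4 a1 a2 a3 a4 b :: nat
  assumes a2: "2 \<le> a2" and a3: "2 \<le> a3" and a4: "2 \<le> a4" and b: "1 \<le> b" and ba1: "b < a1"
    and rel1: "a1 * n1 = n3 + (a4 - 1) * n4"
    and rel2: "b * n1 + n4 = a2 * n2"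
    and rel3: "a3 * n3 = (a1 - b - 1) * n1 + n2"
    and rel4: "a4 * n4 = n1 + (a2 - 1) * n2 + (a3 - 1) * n3"
    and rel5: "(b + 1) * n1 + (a3 - 1) * n3 = n2 + (a4 - 1) * n4"
    and n2_eq: "n2 = b * a3 * a4 + (a1 - b - 1) * (a3 - 1) + a3"
    and residues: "\<exists>p r s. (p * n1 + r * n3 + s * n4) mod n2 = t mod n2"
begin

definition val :: "nat \<Rightarrow> nat \<Rightarrow> nat \<Rightarrow> nat \<Rightarrow> nat" where
  "val p q r s = p * n1 + q * n2 + r * n3 + s * n4"

text \<open>
Divisibility of \<open>X1^p X3^r X4^s\<close> by the left side of a relation whose right side contains \<open>X2\<close>.  The
last case belongs to \<open>X1^(a1+b) - X2^a2 X3 X4^(a4-2)\<close>, obtained from the first two binomials.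
\<close>

definition reducible :: "nat \<Rightarrow> nat \<Rightarrow> nat \<Rightarrow> bool" where
  "reducible p r s \<longleftrightarrow>
     (b \<le> p \<and> 1 \<le> s) \<or> a3 \<le> r \<or> a4 \<le> s \<or> (b + 1 \<le> p \<and> a3 - 1 \<le> r) \<or> a1 + b \<le> p"

text \<open>
The exponents \<open>(p, r, s)\<close> of the monomials \<open>X1^p X3^r X4^s\<close> that none of the five left sides divides.
\<close>

definition normal_monomials :: "(nat \<times> nat \<times> nat) set" where
  "normal_monomials =
     {(p, r, s). p < a1 \<and> r < a3 \<and> s < a4 \<and> (0 < s \<longrightarrow> p < b) \<and> (r = a3 - 1 \<longrightarrow> p \<le> b)}"

definition longest_factorization :: "nat \<Rightarrow> nat \<Rightarrow> nat \<Rightarrow> nat \<Rightarrow> bool" where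
  "longest_factorization p q r s \<longleftrightarrow>
     (\<forall>p' q' r' s'. val p' q' r' s' = val p q r s \<longrightarrow> p' + q' + r' + s' \<le> p + q + r + s)"

definition length_conditions :: bool where
  "length_conditions \<longleftrightarrow>
     b + a3 \<le> a1 \<and> b + a3 \<le> a4 \<and> a4 + 1 \<le> a2 + a3 \<and> b + a1 + 1 \<le> a4 + a2"

lemma n2_pos: "0 < n2"
  using n2_eq a3 by simp

lemma val_add: "val (p + p') (q + q') (r + r') (s + s') = val p q r s + val p' q' r' s'"
  by (simp add: val_def algebra_simps)

lemma swap_first: "val (p + a1) q r s = val p q (r + 1) (s + (a4 - 1))"
  using rel1 by (simp add: val_def algebra_simps)

lemma rel6: "(a1 + b) * n1 = a2 * n2 + n3 + (a4 - 2) * n4"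
proof -
  have "(a4 - 1) * n4 = n4 + (a4 - 2) * n4"
    using a4 by (metis Suc_1 Suc_diff_Suc Suc_le_lessD mult_Suc diff_diff_left plus_1_eq_Suc One_nat_def)
  then show ?thesis using rel1 rel2 by (simp add: algebra_simps)
qed

text \<open>
Of the five steps, those for \<open>X3^a3\<close>, \<open>X4^a4\<close>, \<open>X1^(b+1) X3^(a3-1)\<close> and \<open>X1^(a1+b)\<close> are governed by one
inequality each; that \<open>X1^b X4\<close> does not become shorter, \<open>b + 1 \<le> a2\<close>, follows from the second and the
third inequality.
\<close>

lemma reduce:
  assumes "reducible p r s"
  obtains p' q' r' s' where "0 < q'" "val p' q' r' s' = val p 0 r s"
    "length_conditions \<Longrightarrow> p + r + s \<le> p' + q' + r' + s'"
proof -
  from assms consider "b \<le> p" "1 \<le> s" | "a3 \<le> r" | "a4 \<le> s" | "b + 1 \<le> p" "a3 - 1 \<le> r" | "a1 + b \<le> p"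
    unfolding reducible_def by blast
  then show thesis
  proof cases
    case 1
    then obtain x y where "p = x + b" "s = y + 1" by (metis le_add_diff_inverse2)
    moreover have "val b 0 0 1 = val 0 a2 0 0" using rel2 by (simp add: val_def)
    ultimately show ?thesis
      using that[of a2 x r y] val_add[of x b 0 0 r 0 y 1] val_add[of x 0 0 a2 r 0 y 0] a2
      by (simp add: length_conditions_def)
  next
    case 2
    then obtain x where "r = x + a3" by (metis le_add_diff_inverse2)
    moreover have "val 0 0 a3 0 = val (a1 - b - 1) 1 0 0" using rel3 by (simp add: val_def)
    moreover have "length_conditions \<Longrightarrow> p + r + s \<le> p + (a1 - b - 1) + 1 + x + s"
      using \<open>r = x + a3\<close> by (auto simp: length_conditions_def)
    ultimately show ?thesis
      using that[of 1 "p + (a1 - b - 1)" x s] val_add[of p 0 0 0 x a3 s 0]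
        val_add[of p "a1 - b - 1" 0 1 x 0 s 0]
      by simp
  next
    case 3
    then obtain x where "s = x + a4" by (metis le_add_diff_inverse2)
    moreover have "val 0 0 0 a4 = val 1 (a2 - 1) (a3 - 1) 0" using rel4 by (simp add: val_def)
    moreover have "length_conditions \<Longrightarrow> p + r + s \<le> p + 1 + (a2 - 1) + (r + (a3 - 1)) + x"
      using \<open>s = x + a4\<close> a2 a3 by (auto simp: length_conditions_def)
    ultimately show ?thesis
      using that[of "a2 - 1" "p + 1" "r + (a3 - 1)" x] val_add[of p 0 0 0 r 0 x a4]
        val_add[of p 1 0 "a2 - 1" r "a3 - 1" x 0] a2
      by simp
  next
    case 4
    then obtain x y where "p = x + (b + 1)" "r = y + (a3 - 1)" by (metis le_add_diff_inverse2)
    moreover have "val (b + 1) 0 (a3 - 1) 0 = val 0 1 0 (a4 - 1)" using rel5 by (simp add: val_def)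
    moreover have "length_conditions \<Longrightarrow> p + r + s \<le> x + 1 + y + (s + (a4 - 1))"
      using \<open>p = x + (b + 1)\<close> \<open>r = y + (a3 - 1)\<close> a3 a4 by (auto simp: length_conditions_def)
    ultimately show ?thesis
      using that[of 1 x y "s + (a4 - 1)"] val_add[of x "b + 1" 0 0 y "a3 - 1" s 0]
        val_add[of x 0 0 1 y 0 s "a4 - 1"]
      by simp
  next
    case 5
    then obtain x where "p = x + (a1 + b)" by (metis le_add_diff_inverse2)
    moreover have "val (a1 + b) 0 0 0 = val 0 a2 1 (a4 - 2)" using rel6 by (simp add: val_def)
    moreover have "length_conditions \<Longrightarrow> p + r + s \<le> x + a2 + (r + 1) + (s + (a4 - 2))"
      using \<open>p = x + (a1 + b)\<close> a4 by (auto simp: length_conditions_def)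
    ultimately show ?thesis
      using that[of a2 x "r + 1" "s + (a4 - 2)"] val_add[of x "a1 + b" 0 0 r 0 s 0]
        val_add[of x 0 0 a2 r 1 s "a4 - 2"] a2
      by simp
  qed
qed

text \<open>
An irreducible monomial that is not normal is divisible by \<open>X1^a1\<close>, and one application of the first
relation makes it normal.
\<close>

lemma irreducible_cases:
  assumes "\<not> reducible p r s"
  obtains "(p, r, s) \<in> normal_monomials"
  | p' where "p = p' + a1" "s = 0" "(p', r + 1, a4 - 1) \<in> normal_monomials"
proof (cases "p < a1")
  case True
  with assms that(1) show ?thesis by (fastforce simp: reducible_def normal_monomials_def)
next
  case False
  then obtain p' where p': "p = p' + a1" by (metis add.commute le_add_diff_inverse not_less)
  with assms ba1 b have "s = 0" "(p', r + 1, a4 - 1) \<in> normal_monomials"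
    using a4 by (auto simp: reducible_def normal_monomials_def)
  with p' that(2) show ?thesis by blast
qed

text \<open>
Rewriting ends: a step either raises the exponent of \<open>X2\<close>, which the weight bounds, or keeps it and
lowers the exponent of \<open>X1\<close>.
\<close>

lemma normal_form:
  obtains x k y z where "(x, y, z) \<in> normal_monomials" "q \<le> k" "val x k y z = val p q r s"
proof -
  have "wf (measures [\<lambda>(q, p, r, s). val p q r s - q, \<lambda>(q, p, r, s). p])"
    by simp
  then have "\<exists>x k y z. (x, y, z) \<in> normal_monomials \<and> q \<le> k \<and> val x k y z = val p q r s"
  proof (induction "(q, p, r, s)" arbitrary: p q r s rule: wf_induct_rule)
    case less
    show ?case
    proof (cases "reducible p r s")
      case True
      then obtain p' q' r' s' where e: "0 < q'" "val p' q' r' s' = val p 0 r s"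
        by (rule reduce)
      then have v: "val p' (q + q') r' s' = val p q r s"
        by (simp add: val_def algebra_simps)
      have "q + q' \<le> val p' (q + q') r' s'"
        using n2_pos by (simp add: val_def trans_le_add1 trans_le_add2)
      with v e have "val p' (q + q') r' s' - (q + q') < val p q r s - q" by linarith
      then obtain x k y z where "(x, y, z) \<in> normal_monomials" "q + q' \<le> k"
        "val x k y z = val p' (q + q') r' s'"
        using less[of "q + q'" p' r' s'] by auto
      with v show ?thesis by (metis add_leD1)
    next
      case False
      then show ?thesis
      proof (cases rule: irreducible_cases)
        case 1
        then show ?thesis by blast
      next
        case (2 p')
        then show ?thesis using swap_first[of p' q r 0] by (metis add_0 le_refl)
      qed
    qed
  qed
  then show thesis using that by blast
qed

lemma card_normal_monomials: "finite normal_monomials" "card normal_monomials \<le> n2"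
proof -
  \<comment> \<open>\<open>X4\<close> is absent from the monomials in \<open>?A\<close> and \<open>?B\<close>, which differ by the exponent of \<open>X3\<close> not being
    or being maximal.\<close>
  let ?A = "{..<a1} \<times> {..<a3 - 1} \<times> {0 :: nat}"
  let ?B = "{..b} \<times> {a3 - 1} \<times> {0 :: nat}"
  let ?C = "{..<b} \<times> {..<a3} \<times> {1..<a4}"
  have sub: "normal_monomials \<subseteq> ?A \<union> ?B \<union> ?C"
    by (auto simp: normal_monomials_def)
  then show "finite normal_monomials" by (rule finite_subset) auto
  have "card normal_monomials \<le> card (?A \<union> ?B \<union> ?C)"
    using sub by (intro card_mono) auto
  also have "\<dots> \<le> card ?A + card ?B + card ?C"
    by (meson add_le_mono card_Un_le le_refl le_trans)
  also have "\<dots> = a1 * (a3 - 1) + (b + 1) + b * (a3 * (a4 - 1))"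
    by (simp add: card_cartesian_product)
  also have "\<dots> = n2"
  proof -
    obtain c d e where "a3 = c + 1" "a4 = d + 1" "a1 = e + b + 1"
      using a3 a4 ba1 by (metis add.commute add.assoc add_leD2 le_add_diff_inverse2 less_iff_Suc_add one_add_one plus_1_eq_Suc)
    then show ?thesis by (simp add: n2_eq algebra_simps)
  qed
  finally show "card normal_monomials \<le> n2" .
qed

text \<open>
Every residue class modulo \<open>n2\<close> contains the weight of a normal monomial, and there are not more than
\<open>n2\<close> of them.
\<close>

lemma normal_monomials_residues:
  "inj_on (\<lambda>(x, y, z). val x 0 y z mod n2) normal_monomials"
proof -
  let ?f = "\<lambda>(x, y, z). val x 0 y z mod n2"
  have "{..<n2} \<subseteq> ?f ` normal_monomials"
  proof
    fix t assume "t \<in> {..<n2}"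
    with residues[of t] obtain p r s where t: "t = val p 0 r s mod n2"
      by (auto simp: val_def)
    obtain x k y z where w: "(x, y, z) \<in> normal_monomials" "val x k y z = val p 0 r s"
      using normal_form by metis
    have "val x k y z = val x 0 y z + k * n2" by (simp add: val_def)
    then have "val x k y z mod n2 = val x 0 y z mod n2" by simp
    with w t show "t \<in> ?f ` normal_monomials" by force
  qed
  then have "n2 \<le> card (?f ` normal_monomials)"
    using card_mono[of "?f ` normal_monomials" "{..<n2}"] card_normal_monomials(1) by simp
  with card_normal_monomials card_image_le[OF card_normal_monomials(1), of ?f]
  show ?thesis by (intro eq_card_imp_inj_on) auto
qed

lemma normal_form_unique:
  assumes "(x, y, z) \<in> normal_monomials" "(x', y', z') \<in> normal_monomials"
    and v: "val x k y z = val x' k' y' z'"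
  shows "(x, y, z) = (x', y', z')" "k = k'"
proof -
  have "val x k y z = val x 0 y z + k * n2" for x k y z
    by (simp add: val_def)
  then have "val x 0 y z mod n2 = val x' 0 y' z' mod n2"
    using v by (metis mod_mult_self1)
  then show eq: "(x, y, z) = (x', y', z')"
    using inj_onD[OF normal_monomials_residues _ assms(1,2)] by simp
  then have "k * n2 = k' * n2" using v by (simp only: val_def prod.inject add_left_cancel add_right_cancel)
  with n2_pos show "k = k'" by simp
qed

text \<open>
The normal form of the right side contains \<open>X2\<close>.  The normal form of an irreducible \<open>X1^p X3^r X4^s\<close>
does not, and both are the same by uniqueness.
\<close>

lemma reducible_if_not_Apery:
  assumes v: "val p 0 r s = val p' q' r' s'" and "0 < q'"
  shows "reducible p r s"
proof (rule ccontr)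
  obtain x k y z where w: "(x, y, z) \<in> normal_monomials" "q' \<le> k" "val x k y z = val p' q' r' s'"
    by (rule normal_form)
  assume "\<not> reducible p r s"
  then show False
  proof (cases rule: irreducible_cases)
    case 1
    then show False using normal_form_unique(2)[OF w(1) 1, of k 0] w v \<open>0 < q'\<close> by simp
  next
    case (2 p'')
    then show False
      using normal_form_unique(2)[OF w(1) 2(3), of k 0] w v \<open>0 < q'\<close> swap_first[of p'' 0 r 0] by simp
  qed
qed

text \<open>
Another factorization would be irreducible and reach the normal monomial by one application of the
first relation, whose right side \<open>X3 X4^(a4-1)\<close> would then divide the normal monomial.
\<close>

lemma factorizations_of_normal_monomial:
  assumes n: "(x, y, z) \<in> normal_monomials" and v: "val p q r s = val x 0 y z"
    and ns: "y = 0 \<or> z \<noteq> a4 - 1"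
  shows "p = x \<and> q = 0 \<and> r = y \<and> s = z"
proof -
  \<comment> \<open>The weight of a normal monomial is the least element of the semigroup in its residue class.\<close>
  have Apery: "q' = 0" if "val p' q' r' s' = val x 0 y z" for p' q' r' s'
  proof -
    obtain x' k y' z' where "(x', y', z') \<in> normal_monomials" "q' \<le> k"
      "val x' k y' z' = val p' q' r' s'"
      by (rule normal_form)
    then show ?thesis using normal_form_unique(2)[OF _ n] that by fastforce
  qed
  then have q: "q = 0" using v by blast
  have "\<not> reducible p r s"
    using Apery v q by (metis reduce less_irrefl)
  then show ?thesis
  proof (cases rule: irreducible_cases)
    case 1
    then show ?thesis using normal_form_unique(1)[OF 1 n, of 0 0] v q by simp
  next
    case (2 p')
    then have "(p', r + 1, a4 - 1) = (x, y, z)"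
      using normal_form_unique(1)[OF 2(3) n, of 0 0] v q swap_first[of p' 0 r 0] by simp
    with ns show ?thesis by auto
  qed
qed

text \<open>
For the forward direction, each inequality compares the two sides of a relation in which one side
consists of powers of \<open>X2\<close> and a normal monomial with a single factorization.  The latter is longest,
hence so is the whole side.  For the converse, a factorization of a weight that has some factorization
with \<open>X2\<close> can be replaced by one that contains \<open>X2\<close> and is at least as long; then one \<open>X2\<close> is removed
from it.
\<close>

lemma longest_stable_iff:
  "(\<forall>p q r s. longest_factorization p q r s \<longrightarrow> longest_factorization p (q + 1) r s) \<longleftrightarrow> length_conditions"
proof
  assume stable: "\<forall>p q r s. longest_factorization p q r s \<longrightarrow> longest_factorization p (q + 1) r s"
  \<comment> \<open>A normal monomial with a single factorization is longest, and then by stability so is its product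
    with any power of \<open>X2\<close>.\<close>
  have bound: "p + q + r + s \<le> x + k + y + z"
    if "(x, y, z) \<in> normal_monomials" "y = 0 \<or> z \<noteq> a4 - 1" "val p q r s = val x k y z"
    for p q r s x k y z
  proof -
    have "longest_factorization x 0 y z"
      unfolding longest_factorization_def using factorizations_of_normal_monomial[OF that(1) _ that(2)] by fastforce
    then have "longest_factorization x k y z"
      by (induction k) (use stable in auto)
    with that(3) show ?thesis by (simp add: longest_factorization_def)
  qed
  have "b + a3 \<le> a1"
    using bound[of "a1 - b - 1" 0 0 0 0 a3 0 1] rel3 b ba1 a3 a4
    by (simp add: normal_monomials_def val_def)
  moreover have "b + a3 \<le> a4"
    using bound[of 0 0 "a4 - 1" "b + 1" 0 "a3 - 1" 0 1] rel5 b ba1 a3 a4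
    by (simp add: normal_monomials_def val_def)
  moreover have "a4 + 1 \<le> a2 + a3"
    using bound[of 1 "a3 - 1" 0 0 0 0 a4 "a2 - 1"] rel4 b ba1 a2 a3 a4
    by (simp add: normal_monomials_def val_def)
  moreover have "a4 - 2 \<noteq> a4 - 1" using a4 by simp
  then have "b + a1 + 1 \<le> a4 + a2"
    using bound[of 0 1 "a4 - 2" "a1 + b" 0 0 0 a2] rel6 b ba1 a3 a4
    by (simp add: normal_monomials_def val_def)
  ultimately show length_conditions
    by (simp add: length_conditions_def)
next
  assume lc: length_conditions
  show "\<forall>p q r s. longest_factorization p q r s \<longrightarrow> longest_factorization p (q + 1) r s"
  proof (intro allI impI)
    fix p q r s assume l: "longest_factorization p q r s"
    \<comment> \<open>A factorization that contains \<open>X2\<close> comes from one of the original element.\<close>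
    have pos: "p' + q' + r' + s' \<le> p + (q + 1) + r + s"
      if v: "val p' q' r' s' = val p (q + 1) r s" and "0 < q'" for p' q' r' s'
    proof -
      obtain k where k: "q' = k + 1" using \<open>0 < q'\<close> by (metis Suc_eq_plus1 gr0_implies_Suc)
      with v have "val p' k r' s' = val p q r s" by (simp add: val_def)
      with l k show ?thesis by (fastforce simp: longest_factorization_def)
    qed
    show "longest_factorization p (q + 1) r s"
      unfolding longest_factorization_def
    proof (intro allI impI)
      fix p' q' r' s' assume v: "val p' q' r' s' = val p (q + 1) r s"
      show "p' + q' + r' + s' \<le> p + (q + 1) + r + s"
      proof (cases "q' = 0")
        case True
        then have "reducible p' r' s'" using v by (intro reducible_if_not_Apery) auto
        then obtain u1 u2 u3 u4 where "0 < u2" "val u1 u2 u3 u4 = val p' 0 r' s'"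
          "p' + r' + s' \<le> u1 + u2 + u3 + u4"
          using lc by (metis reduce)
        then show ?thesis using pos[of u1 u2 u3 u4] v True by simp
      qed (use pos v in auto)
    qed
  qed
qed

end

section \<open>The tangent cone of the curve\<close>

text \<open>
Bezout coefficients for the four generators, multiplied by \<open>t\<close> and reduced modulo \<open>n 2\<close> to make them
nonnegative; the multiple of \<open>n 2\<close> itself drops out.
\<close>

lemma Gcd_eq_1_residues:
  fixes n :: "nat ^ 4"
  assumes "Gcd (range (($) n)) = 1" "0 < n $ 2"
  shows "\<exists>p r s. (p * n $ 1 + r * n $ 3 + s * n $ 4) mod n $ 2 = t mod n $ 2"
proof -
  let ?m = "int (n $ 2)"
  obtain u v where uv: "u * int (n $ 1) + v * int (n $ 2) = gcd (int (n $ 1)) (int (n $ 2))"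
    using bezout_int by blast
  obtain w x where wx: "w * int (n $ 3) + x * int (n $ 4) = gcd (int (n $ 3)) (int (n $ 4))"
    using bezout_int by blast
  obtain y z where yz: "y * gcd (int (n $ 1)) (int (n $ 2)) + z * gcd (int (n $ 3)) (int (n $ 4)) =
      gcd (gcd (int (n $ 1)) (int (n $ 2))) (gcd (int (n $ 3)) (int (n $ 4)))"
    using bezout_int by blast
  have "gcd (gcd (n $ 1) (n $ 2)) (gcd (n $ 3) (n $ 4)) = 1"
    using assms(1) by (simp add: UNIV_4 gcd.assoc)
  then have one: "y * (u * int (n $ 1) + v * ?m) + z * (w * int (n $ 3) + x * int (n $ 4)) = 1"
    unfolding uv wx yz by (metis gcd_int_int_eq of_nat_1)
  define c where "c k = nat ((k * int t) mod ?m)" for k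
  have c: "[int (c k) = k * int t] (mod ?m)" for k
    using assms(2) by (simp add: c_def cong_def)
  have "[int (c (y * u) * n $ 1 + c (z * w) * n $ 3 + c (z * x) * n $ 4) =
      (y * u * int t) * int (n $ 1) + (z * w * int t) * int (n $ 3) + (z * x * int t) * int (n $ 4)] (mod ?m)"
    unfolding of_nat_add of_nat_mult by (intro cong_add cong_mult c cong_refl)
  also have "(y * u * int t) * int (n $ 1) + (z * w * int t) * int (n $ 3) + (z * x * int t) * int (n $ 4)
      = (y * (u * int (n $ 1) + v * ?m) + z * (w * int (n $ 3) + x * int (n $ 4))) * int t - y * v * int t * ?m"
    by (simp add: algebra_simps)
  also have "\<dots> = int t - y * v * int t * ?m" unfolding one by simp
  also have "[int t - y * v * int t * ?m = int t] (mod ?m)"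
    by (simp add: cong_iff_dvd_diff)
  finally have "[c (y * u) * n $ 1 + c (z * w) * n $ 3 + c (z * x) * n $ 4 = t] (mod n $ 2)"
    by (simp only: cong_int_iff)
  then show ?thesis unfolding cong_def by blast
qed

lemma komeda_weights_of_defining_integers:
  assumes d: "defining_integers n \<alpha>1 \<alpha>2 \<alpha>3 \<alpha>4 \<alpha>21" and gcd: "Gcd (range (($) n)) = 1"
    and pos: "0 < n $ 2"
  shows "komeda_weights (n $ 1) (n $ 2) (n $ 3) (n $ 4) (nat \<alpha>1) (nat \<alpha>2) (nat \<alpha>3) (nat \<alpha>4) (nat \<alpha>21)"
proof -
  have eqs: "int (n $ 1) = \<alpha>2 * \<alpha>3 * (\<alpha>4 - 1) + 1"
    "int (n $ 2) = \<alpha>21 * \<alpha>3 * \<alpha>4 + (\<alpha>1 - \<alpha>21 - 1) * (\<alpha>3 - 1) + \<alpha>3"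
    "int (n $ 3) = \<alpha>1 * \<alpha>4 + (\<alpha>1 - \<alpha>21 - 1) * (\<alpha>2 - 1) * (\<alpha>4 - 1) - \<alpha>4 + 1"
    "int (n $ 4) = \<alpha>1 * \<alpha>2 * (\<alpha>3 - 1) + \<alpha>21 * (\<alpha>2 - 1) + \<alpha>2"
    and bounds: "1 < \<alpha>1" "1 < \<alpha>2" "1 < \<alpha>3" "1 < \<alpha>4" "0 < \<alpha>21" "\<alpha>21 < \<alpha>1"
    using d by (auto simp: defining_integers_def)
  have int_minus: "int (nat x - 1) = x - 1" if "1 < x" for x using that by simp
  have int_minus2: "int (nat \<alpha>1 - nat \<alpha>21 - 1) = \<alpha>1 - \<alpha>21 - 1" using bounds by simp
  have int_nat: "int (nat \<alpha>1) = \<alpha>1" "int (nat \<alpha>2) = \<alpha>2" "int (nat \<alpha>3) = \<alpha>3" "int (nat \<alpha>4) = \<alpha>4"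
    "int (nat \<alpha>21) = \<alpha>21" using bounds by auto
  note ints = int_minus[OF bounds(2)] int_minus[OF bounds(3)] int_minus[OF bounds(4)] int_minus2 int_nat
  show ?thesis
  proof
    show "2 \<le> nat \<alpha>2" "2 \<le> nat \<alpha>3" "2 \<le> nat \<alpha>4" "1 \<le> nat \<alpha>21" "nat \<alpha>21 < nat \<alpha>1"
      using bounds by auto
    have "int (nat \<alpha>1 * n $ 1) = int (n $ 3 + (nat \<alpha>4 - 1) * n $ 4)"
      unfolding of_nat_add of_nat_mult ints eqs by (simp add: algebra_simps)
    then show "nat \<alpha>1 * n $ 1 = n $ 3 + (nat \<alpha>4 - 1) * n $ 4" by (simp only: of_nat_eq_iff)
    have "int (nat \<alpha>21 * n $ 1 + n $ 4) = int (nat \<alpha>2 * n $ 2)"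
      unfolding of_nat_add of_nat_mult ints eqs by (simp add: algebra_simps)
    then show "nat \<alpha>21 * n $ 1 + n $ 4 = nat \<alpha>2 * n $ 2" by (simp only: of_nat_eq_iff)
    have "int (nat \<alpha>3 * n $ 3) = int ((nat \<alpha>1 - nat \<alpha>21 - 1) * n $ 1 + n $ 2)"
      unfolding of_nat_add of_nat_mult ints eqs by (simp add: algebra_simps)
    then show "nat \<alpha>3 * n $ 3 = (nat \<alpha>1 - nat \<alpha>21 - 1) * n $ 1 + n $ 2" by (simp only: of_nat_eq_iff)
    have "int (nat \<alpha>4 * n $ 4) = int (n $ 1 + (nat \<alpha>2 - 1) * n $ 2 + (nat \<alpha>3 - 1) * n $ 3)"
      unfolding of_nat_add of_nat_mult ints eqs by (simp add: algebra_simps)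
    then show "nat \<alpha>4 * n $ 4 = n $ 1 + (nat \<alpha>2 - 1) * n $ 2 + (nat \<alpha>3 - 1) * n $ 3"
      by (simp only: of_nat_eq_iff)
    have "int ((nat \<alpha>21 + 1) * n $ 1 + (nat \<alpha>3 - 1) * n $ 3) = int (n $ 2 + (nat \<alpha>4 - 1) * n $ 4)"
      unfolding of_nat_add of_nat_mult of_nat_1 ints eqs by (simp add: algebra_simps)
    then show "(nat \<alpha>21 + 1) * n $ 1 + (nat \<alpha>3 - 1) * n $ 3 = n $ 2 + (nat \<alpha>4 - 1) * n $ 4"
      by (simp only: of_nat_eq_iff)
    have "int (n $ 2) = int (nat \<alpha>21 * nat \<alpha>3 * nat \<alpha>4 + (nat \<alpha>1 - nat \<alpha>21 - 1) * (nat \<alpha>3 - 1) + nat \<alpha>3)"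
      unfolding of_nat_add of_nat_mult ints eqs by simp
    then show "n $ 2 = nat \<alpha>21 * nat \<alpha>3 * nat \<alpha>4 + (nat \<alpha>1 - nat \<alpha>21 - 1) * (nat \<alpha>3 - 1) + nat \<alpha>3"
      by (simp only: of_nat_eq_iff)
    show "\<exists>p r s. (p * n $ 1 + r * n $ 3 + s * n $ 4) mod n $ 2 = t mod n $ 2" for t
      by (rule Gcd_eq_1_residues[OF gcd pos])
  qed
qed

text \<open>
Of two equal generators one can be omitted.
\<close>

lemma minimal_generators_distinct:
  assumes "minimal_generators n" "i \<noteq> j"
  shows "n $ i \<noteq> n $ j"
proof
  assume eq: "n $ i = n $ j"
  have "x \<in> semigroup_gen (UNIV - {i}) n" if x: "x \<in> semigroup_gen UNIV n" for x
  proof -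
    obtain u :: "4 \<Rightarrow> nat" where u: "x = (\<Sum>k\<in>UNIV. int (u k * n $ k))"
      using x by (auto simp: semigroup_gen_def)
    define v where "v = u(j := u j + u i)"
    have ins: "UNIV = insert i (insert j (UNIV - {i, j}))" by blast
    have ins2: "UNIV - {i} = insert j (UNIV - {i, j})" using assms(2) by blast
    have "(\<Sum>k\<in>UNIV - {i}. int (v k * n $ k)) = int (v j * n $ j) + (\<Sum>k\<in>UNIV - {i, j}. int (v k * n $ k))"
      unfolding ins2 by (subst sum.insert) auto
    also have "(\<Sum>k\<in>UNIV - {i, j}. int (v k * n $ k)) = (\<Sum>k\<in>UNIV - {i, j}. int (u k * n $ k))"
      by (intro sum.cong) (auto simp: v_def)
    also have "int (v j * n $ j) = int (u i * n $ i) + int (u j * n $ j)"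
      by (simp add: v_def eq algebra_simps)
    also have "\<dots> + (\<Sum>k\<in>UNIV - {i, j}. int (u k * n $ k)) = x"
      unfolding u by (subst (2) ins) (use assms(2) in \<open>simp add: sum.insert del: of_nat_mult\<close>)
    finally have "x = (\<Sum>k\<in>UNIV - {i}. int (v k * n $ k))" by simp
    then show ?thesis by (auto simp: semigroup_gen_def)
  qed
  moreover have "x \<in> semigroup_gen UNIV n" if x: "x \<in> semigroup_gen (UNIV - {i}) n" for x
  proof -
    obtain u :: "4 \<Rightarrow> nat" where u: "x = (\<Sum>k\<in>UNIV - {i}. int (u k * n $ k))"
      using x by (auto simp: semigroup_gen_def)
    also have "\<dots> = (\<Sum>k\<in>UNIV. int ((u(i := 0)) k * n $ k))"
      by (rule sum.mono_neutral_cong_left) auto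
    finally show ?thesis by (auto simp: semigroup_gen_def)
  qed
  ultimately have "semigroup_gen (UNIV - {i}) n = semigroup_gen UNIV n" by blast
  moreover have "UNIV - {i} \<noteq> UNIV" by blast
  ultimately show False using assms(1) unfolding minimal_generators_def by simp
qed

lemma longest_iff_komeda:
  assumes "komeda_weights (n $ 1) (n $ 2) (n $ 3) (n $ 4) a1 a2 a3 a4 b"
  shows "(\<forall>e. longest n e \<longrightarrow> longest n (e + axis2 1)) \<longleftrightarrow>
    komeda_weights.length_conditions a1 a2 a3 a4 b"
proof -
  interpret komeda_weights "n $ 1" "n $ 2" "n $ 3" "n $ 4" a1 a2 a3 a4 b by fact
  define vec where "vec p q r s = (\<chi> i :: 4. if i = 1 then p else if i = 2 then q else if i = 3 then r else s)"
    for p q r s :: nat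
  have vec: "vec p q r s $ 1 = p" "vec p q r s $ 2 = q" "vec p q r s $ 3 = r" "vec p q r s $ 4 = s" for p q r s
    by (simp_all add: vec_def)
  have all: "(\<forall>e :: nat ^ 4. P e) \<longleftrightarrow> (\<forall>p q r s. P (vec p q r s))" for P
  proof
    assume P: "\<forall>p q r s. P (vec p q r s)"
    show "\<forall>e. P e"
    proof
      fix e :: "nat ^ 4"
      have "e = vec (e $ 1) (e $ 2) (e $ 3) (e $ 4)" by (simp add: vec_eq_iff forall_4 vec)
      with P show "P e" by metis
    qed
  qed blast
  have weight: "weight n (vec p q r s) = val p q r s" for p q r s
    by (simp add: weight_def val_def sum_4 vec)
  have degree: "total_degree (vec p q r s) = p + q + r + s" for p q r s
    by (simp add: total_degree_def sum_4 vec)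
  have longest: "longest n (vec p q r s) \<longleftrightarrow> longest_factorization p q r s" for p q r s
    unfolding longest_factorization_def longest_def all[where P = "\<lambda>f. weight n f = _ \<longrightarrow> _ f"] weight degree ..
  have "vec p q r s + axis2 1 = vec p (q + 1) r s" for p q r s
    by (simp add: vec_eq_iff forall_4 vec axis2_def)
  then show ?thesis
    unfolding all[where P = "\<lambda>e. longest n e \<longrightarrow> longest n (e + axis2 1)"]
    using longest_stable_iff by (simp add: longest)
qed

theorem theorem3p9:
  fixes n :: "nat ^ 4" and \<alpha>1 \<alpha>2 \<alpha>3 \<alpha>4 \<alpha>21 :: int
  assumes "\<forall>i. n $ i > 0"
    and "Gcd (range (($) n)) = 1"
    and "minimal_generators n"
    and "pseudo_symmetric (semigroup_gen UNIV n)"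
    and "defining_integers n \<alpha>1 \<alpha>2 \<alpha>3 \<alpha>4 \<alpha>21"
    and "\<forall>i. n $ 2 \<le> n $ i"
  shows "cohen_macaulay (tangent_cone_ring n :: 'k :: field poly4 set ring) \<longleftrightarrow>
           \<alpha>21 + \<alpha>3 \<le> \<alpha>1 \<and>
           \<alpha>21 + \<alpha>3 \<le> \<alpha>4 \<and>
           \<alpha>4 \<le> \<alpha>2 + \<alpha>3 - 1 \<and>
           \<alpha>21 + \<alpha>1 \<le> \<alpha>4 + \<alpha>2 - 1"
proof -
  interpret smallest_second n
  proof
    show "0 < n $ i" for i using assms(1) by blast
    show "n $ 2 < n $ i" if "i \<noteq> 2" for i
      using assms(6) minimal_generators_distinct[OF assms(3) that] by (simp add: order_less_le)
  qed
  have kw: "komeda_weights (n $ 1) (n $ 2) (n $ 3) (n $ 4) (nat \<alpha>1) (nat \<alpha>2) (nat \<alpha>3) (nat \<alpha>4) (nat \<alpha>21)"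
    by (rule komeda_weights_of_defining_integers[OF assms(5,2) pos])
  have "1 < \<alpha>1" "1 < \<alpha>2" "1 < \<alpha>3" "1 < \<alpha>4" "0 < \<alpha>21"
    using assms(5) by (auto simp: defining_integers_def)
  then have "komeda_weights.length_conditions (nat \<alpha>1) (nat \<alpha>2) (nat \<alpha>3) (nat \<alpha>4) (nat \<alpha>21) \<longleftrightarrow>
      \<alpha>21 + \<alpha>3 \<le> \<alpha>1 \<and> \<alpha>21 + \<alpha>3 \<le> \<alpha>4 \<and> \<alpha>4 \<le> \<alpha>2 + \<alpha>3 - 1 \<and> \<alpha>21 + \<alpha>1 \<le> \<alpha>4 + \<alpha>2 - 1"
    unfolding komeda_weights.length_conditions_def[OF kw] by linarith
  then show ?thesis
    unfolding cohen_macaulay_iff_longest_stable longest_iff_komeda[OF kw] .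
qed

end
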